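(* Let $W_\varepsilon=(W_\varepsilon^+,W_\varepsilon^-)$ be the planar piecewise linear vector field $$W_\varepsilon(x,y)=\begin{cases}M_\varepsilon^+\binom{x}{y}+\binom{u_{1,\varepsilon}^+}{u_{2,\varepsilon}^+}, & x\ge0,\\[1mm] M_\varepsilon^-\binom{x}{y}+\binom{u_{1,\varepsilon}^-}{u_{2,\varepsilon}^-}, & x\le0,\end{cases}$$ where $M_\varepsilon^\pm$ are one-parameter families of real $2\times2$ matrices and $u_{1,\varepsilon}^\pm,u_{2,\varepsilon}^\pm\in\mathbb R$. Let $p^\pm$ be the singular point of $W_0^\pm$ and assume: (H1) $p^-$ is a center of $W_0^-$ and $p^-\in\{x<0\}$; (H2) $p^+$ is a center of $W_0^+$ and $p^+\in\{x<0\}$; (H3) $p^-$ is a global center of $W_0$. Write $$M_0^\pm=\begin{pmatrix}m_{11}^\pm&m_{12}^\pm\\ m_{21}^\pm&-m_{11}^\pm\end{pmatrix},\qquad u_2^\pm=u_{2,0}^\pm+\frac{m_{11}^\pm u_{1,0}^\pm}{m_{12}^\pm}.$$ Then there exists a change of coordinates and time $(t,x,y)\mapsto(\tilde t,x,\tilde y)$, mapping the half-planes $x\ge0$ and $x\le0$ to themselves, in which the system $(\dot x,\dot y)^T=W_\varepsilon(x,y)$ is written as $(x',\tilde y')^T=Z_\varepsilon(x,\tilde y)$, where $$Z_0(x,\tilde y)=\begin{cases}\begin{pmatrix}a&b\\c&-a\end{pmatrix}\binom{x}{\tilde y}+\binom{0}{d},& x\ge0,\\[2mm] \begin{pmatrix}0&-1\\1&0\end{pmatrix}\binom{x}{\tilde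 y}+\binom{0}{e},& x\le0,\end{cases}$$ with $$\rho=\sqrt{|\det(M_0^-)|},\quad a=\frac1\rho\Big(m_{11}^+-\frac{m_{11}^-m_{12}^+}{m_{12}^-}\Big),\quad b=-\frac{m_{12}^+}{m_{12}^-},$$ $$c=\frac1{\rho^2}\Big(\frac{(m_{11}^-)^2m_{12}^+}{m_{12}^-}-2m_{11}^-m_{11}^+-m_{12}^-m_{21}^+\Big),\quad d=-\frac{m_{12}^-u_2^+}{\rho},\quad e=-\frac{m_{12}^-u_2^-}{\rho}.$$ Furthermore, the parameters of this canonical form satisfy $$b<0,\quad c>0,\quad d>0,\quad e>0,\quad a^2+bc<0.$$
   Context: Solutions of piecewise linear systems separated by $\Sigma=\{x=0\}$ follow Filippov's convention. A center is a singular point having a neighborhood $U$ such that $U$ minus the point is filled by periodic orbits; a global center is one whose period annulus (the union of periodic orbits around it) is the whole plane minus the singular point. The matrices $M_0^\pm$ are traceless because $p^\pm$ are centers of the linear systems $W_0^\pm$. The numbers $u_2^\pm$ are the second components of the constant vectors of $W_0^\pm$ after the translation in $y$ that makes the first components of these constant vectors vanish; they equal $u_{2,0}^\pm$ when $u_{1,0}^\pm=0$.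
   Formalization: The change of coordinates may rescale x by a positive constant (necessarily ρ) instead of keeping x fixed: with the displayed d and e, x unchanged fails, e.g. for W⁺=W⁻=(−2y,2x+2), where p⁻ has x=−1 but the canonical left singular point has x=−2. *)

theory Defs
  imports "HOL-Analysis.Analysis"
begin

definition affine_field :: "real^2^2 \<Rightarrow> real^2 \<Rightarrow> real^2 \<Rightarrow> real^2" where
  "affine_field M u z = M *v z + u"

definition right_half :: "(real^2) set" where
  "right_half = {z. z $ 1 \<ge> 0}"

definition left_half :: "(real^2) set" where
  "left_half = {z. z $ 1 \<le> 0}"

text \<open>Filippov's convexification, for the switching line \<open>x = 0\<close>, of the piecewise field that
  is \<open>Xp\<close> on the right and \<open>Xm\<close> on the left.\<close>

definition filippov :: "(real^2 \<Rightarrow> real^2) \<Rightarrow> (real^2 \<Rightarrow> real^2) \<Rightarrow> real^2 \<Rightarrow> (real^2) set" where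
  "filippov Xp Xm z =
     (if z $ 1 > 0 then {Xp z}
      else if z $ 1 < 0 then {Xm z}
      else closed_segment (Xp z) (Xm z))"

text \<open>A continuous vector field, as a differential inclusion; its solutions in the sense below are
  the classical ones.\<close>

definition ode_system :: "(real^2 \<Rightarrow> real^2) \<Rightarrow> real^2 \<Rightarrow> (real^2) set" where
  "ode_system X z = {X z}"

text \<open>Solutions of \<open>z' \<in> F z\<close> on the whole time axis: (locally) absolutely continuous curves
  satisfying the inclusion almost everywhere. Absolute continuity is expressed by \<open>g\<close> being an
  indefinite Lebesgue integral of a function \<open>v\<close>, which is then its derivative almost everywhere.\<close>

definition solution :: "(real^2 \<Rightarrow> (real^2) set) \<Rightarrow> (real \<Rightarrow> real^2) \<Rightarrow> bool" where
  "solution F g \<longleftrightarrow>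
     (\<exists>v. (\<forall>s t. s \<le> t \<longrightarrow>
              v absolutely_integrable_on {s..t} \<and> (v has_integral (g t - g s)) {s..t}) \<and>
          (AE t in lebesgue. v t \<in> F (g t)))"

text \<open>Periodic orbits are closed orbits, i.e. simple closed curves: injectivity on one period is not
  automatic, because Filippov solutions may merge or branch on sliding segments. It also makes \<open>T\<close>
  the minimal period and excludes constant solutions.\<close>

definition periodic_orbit :: "(real^2 \<Rightarrow> (real^2) set) \<Rightarrow> (real^2) set \<Rightarrow> bool" where
  "periodic_orbit F C \<longleftrightarrow>
     (\<exists>g T. T > 0 \<and> solution F g \<and> (\<forall>t. g (t + T) = g t) \<and> inj_on g {0..<T} \<and> C = range g)"

definition singular_point :: "(real^2 \<Rightarrow> (real^2) set) \<Rightarrow> real^2 \<Rightarrow> bool" where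
  "singular_point F p \<longleftrightarrow> 0 \<in> F p"

definition is_center :: "(real^2 \<Rightarrow> (real^2) set) \<Rightarrow> real^2 \<Rightarrow> bool" where
  "is_center F p \<longleftrightarrow>
     singular_point F p \<and>
     (\<exists>U. open U \<and> p \<in> U \<and> U - {p} = \<Union>{C. periodic_orbit F C \<and> C \<subseteq> U - {p}})"

text \<open>\<open>inside C\<close> is the union of the bounded components of the complement of \<open>C\<close>.\<close>

definition period_annulus :: "(real^2 \<Rightarrow> (real^2) set) \<Rightarrow> real^2 \<Rightarrow> (real^2) set" where
  "period_annulus F p = \<Union>{C. periodic_orbit F C \<and> p \<in> inside C}"

definition is_global_center :: "(real^2 \<Rightarrow> (real^2) set) \<Rightarrow> real^2 \<Rightarrow> bool" where
  "is_global_center F p \<longleftrightarrow> is_center F p \<and> period_annulus F p = UNIV - {p}"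

text \<open>The change \<open>(t, z) \<mapsto> (\<sigma> t, h z)\<close>, where \<open>h\<close> is an affine isomorphism \<open>(x, y) \<mapsto> (k x, y~)\<close>
  with \<open>k > 0\<close>. The scale \<open>k\<close> cannot be dropped: with
  \<open>\<rho>\<close> the square root of the determinant of a left linear center with abscissa \<open>x0\<close>, the constant
  \<open>e = - m12 * u2 / \<rho>\<close> equals \<open>- \<rho> * x0\<close>, while the center of
  \<open>(x', y') = (- y, x + e)\<close> has abscissa \<open>- e\<close>; so \<open>k = \<rho>\<close>.\<close>

definition coordinate_time_change :: "(real^2 \<Rightarrow> real^2) \<Rightarrow> real \<Rightarrow> bool" where
  "coordinate_time_change h \<sigma> \<longleftrightarrow>
     \<sigma> > 0 \<and>
     (\<exists>A w. invertible (A :: real^2^2) \<and> h = (\<lambda>z. A *v z + w)) \<and>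
     (\<exists>k > 0. \<forall>z. h z $ 1 = k * z $ 1) \<and>
     h ` right_half = right_half \<and> h ` left_half = left_half"

text \<open>On \<open>S\<close>, the system \<open>dz/dt = X z\<close> reads \<open>dw/ds = Y w\<close> in the variables \<open>w = h z\<close>,
  \<open>s = \<sigma> t\<close>.\<close>

definition written_as ::
  "(real^2 \<Rightarrow> real^2) \<Rightarrow> real \<Rightarrow> (real^2) set \<Rightarrow> (real^2 \<Rightarrow> real^2) \<Rightarrow> (real^2 \<Rightarrow> real^2) \<Rightarrow> bool" where
  "written_as h \<sigma> S X Y \<longleftrightarrow>
     (\<forall>z \<in> S. \<exists>D. (h has_derivative D) (at z) \<and> D (X z) = \<sigma> *\<^sub>R Y (h z))"

end

theory Submission
  imports Defs
begin

text \<open>The change of coordinates straightens the left system: \<open>y~\<close> is a multiple of the left \<open>x'\<close>.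
  It puts the right system into the canonical form exactly when the tangency points of both systems
  on \<open>x = 0\<close> coincide, and \<open>b < 0\<close> says that both systems cross the line in the same direction.
  Both facts come from the global center. Being Hamiltonian, each system maps a point of the line
  where an orbit leaves it to the point where the orbit comes back by reflection in its own
  tangency point. If the directions agree but the tangency points \<open>l\<close>, \<open>r\<close> differ, far orbits
  spiral. If the directions disagree, there is an attracting sliding half-line (or, in reversed
  time, an escaping one) on which a closed orbit visiting both sides would land twice, and it would
  pass the upper landing point twice in one period. The closed orbit does visit \<open>x < 0\<close> because it
  surrounds \<open>p\<close>.\<close>

section \<open>Closed curves crossing a line\<close>

lemma periodic_int:
  fixes T :: real
  assumes per: "\<And>t. f (t + T) = f t"
  shows "f (t + of_int k * T) = f t"
proof -
  have nat: "f (t + of_nat n * T) = f t" for n t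
  proof (induction n)
    case (Suc n)
    have "t + of_nat (Suc n) * T = (t + of_nat n * T) + T" by (simp add: algebra_simps)
    with Suc per show ?case by metis
  qed simp
  show ?thesis
  proof (cases k)
    case (nonneg n)
    then show ?thesis using nat[of t n] by simp
  next
    case (neg n)
    then have "of_int k = - of_nat (Suc n) * (1 :: real)" by simp
    then have "t + of_int k * T + of_nat (Suc n) * T = t" by (simp only:)
    then show ?thesis using nat[of "t + of_int k * T" "Suc n"] by metis
  qed
qed

lemma translate_into_period:
  fixes s t T :: real
  assumes "T > 0"
  obtains k :: int where "s \<le> t + of_int k * T" "t + of_int k * T < s + T"
proof
  let ?k = "\<lceil>(s - t) / T\<rceil>"
  have "(s - t) / T \<le> of_int ?k" "of_int ?k < (s - t) / T + 1" by linarith+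
  then have "(s - t) / T * T \<le> of_int ?k * T" "of_int ?k * T < ((s - t) / T + 1) * T"
    using assms by (intro mult_right_mono mult_strict_right_mono; simp)+
  moreover have "(s - t) / T * T = s - t" using assms by simp
  ultimately show "s \<le> t + of_int ?k * T" "t + of_int ?k * T < s + T"
    unfolding distrib_right by linarith+
qed

text \<open>The interval is the connected component of \<open>{q. f q > 0}\<close> around
  \<open>t\<close>. Its ends are the last nonpositive time before \<open>t\<close> and the first one
  after it, which exist by compactness.\<close>

lemma nonzero_component:
  fixes f :: "real \<Rightarrow> real"
  assumes cont: "continuous_on UNIV f" and "f t > 0" "f a \<le> 0" "a < t" "f b \<le> 0" "t < b"
  obtains s u where "s < t" "t < u" "f s = 0" "f u = 0" "\<And>q. s < q \<Longrightarrow> q < u \<Longrightarrow> f q > 0"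
proof -
  have c: "closed ({q. f q \<le> 0} \<inter> {a..t})" "closed ({q. f q \<le> 0} \<inter> {t..b})"
    by (intro closed_Int closed_Collect_le continuous_intros cont closed_atLeastAtMost)+
  have cs: "compact ({q. f q \<le> 0} \<inter> {a..t})" "compact ({q. f q \<le> 0} \<inter> {t..b})"
    by (auto intro!: c compact_eq_bounded_closed[THEN iffD2] bounded_Int)
  have ne: "a \<in> {q. f q \<le> 0} \<inter> {a..t}" "b \<in> {q. f q \<le> 0} \<inter> {t..b}" using assms by auto
  obtain s where "s \<in> {q. f q \<le> 0} \<inter> {a..t}" "\<forall>q \<in> {q. f q \<le> 0} \<inter> {a..t}. q \<le> s"
    using compact_attains_sup[OF cs(1)] ne by blast
  then have s: "f s \<le> 0" "a \<le> s" "s \<le> t" "\<And>q. f q \<le> 0 \<Longrightarrow> a \<le> q \<Longrightarrow> q \<le> t \<Longrightarrow> q \<le> s"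
    by auto
  obtain u where "u \<in> {q. f q \<le> 0} \<inter> {t..b}" "\<forall>q \<in> {q. f q \<le> 0} \<inter> {t..b}. u \<le> q"
    using compact_attains_inf[OF cs(2)] ne by blast
  then have u: "f u \<le> 0" "t \<le> u" "u \<le> b" "\<And>q. f q \<le> 0 \<Longrightarrow> t \<le> q \<Longrightarrow> q \<le> b \<Longrightarrow> u \<le> q"
    by auto
  have "s \<noteq> t" "u \<noteq> t" using s u assms by auto
  then have st: "s < t" "t < u" using s u by auto
  have pos: "f q > 0" if "s < q" "q < u" for q
    using s(4)[of q] u(4)[of q] that s(2) u(3) by fastforce
  \<comment> \<open>Extremality gives only \<open>f s \<le> 0\<close>. The intermediate value
    theorem supplies a zero in \<open>[s, t]\<close>, and positivity between \<open>s\<close> and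
    \<open>u\<close> forces that zero to be \<open>s\<close>; likewise for \<open>u\<close>.\<close>
  obtain s' where "s \<le> s'" "s' \<le> t" "f s' = 0"
    using IVT'[of f s 0 t] s st assms continuous_on_subset[OF cont] by auto
  then have "f s = 0" using pos[of s'] st by (cases "s' = s") auto
  obtain u' where "t \<le> u'" "u' \<le> u" "f u' = 0"
    using IVT2'[of f u 0 t] u st assms continuous_on_subset[OF cont] by auto
  then have "f u = 0" using pos[of u'] st by (cases "u' = u") auto
  show thesis using that[OF st \<open>f s = 0\<close> \<open>f u = 0\<close> pos] .
qed

text \<open>\<open>simple\<close> is injectivity on a period, phrased for arbitrary times so that
  coincidences can be compared without normalising them. \<open>visits_left\<close> ensures that no
  excursion into \<open>x > 0\<close> lasts forever.\<close>

locale closed_curve =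
  fixes x y :: "real \<Rightarrow> real" and T :: real
  assumes T_pos: "T > 0"
    and cont_x: "continuous_on UNIV x" and cont_y: "continuous_on UNIV y"
    and periodic: "x (t + T) = x t" "y (t + T) = y t"
    and simple: "x s = x t \<Longrightarrow> y s = y t \<Longrightarrow> \<exists>k::int. t = s + of_int k * T"
    and visits_left: "\<exists>t. x t < 0"
begin

lemmas x_periodic_int = periodic_int[of x T, OF periodic(1)]
lemmas y_periodic_int = periodic_int[of y T, OF periodic(2)]

lemma right_arcE:
  assumes "x t > 0"
  obtains s u where "s < t" "t < u" "x s = 0" "x u = 0" "\<And>q. s < q \<Longrightarrow> q < u \<Longrightarrow> x q > 0"
proof -
  from visits_left obtain c where c: "x c < 0" by blast
  obtain k :: int where k: "t \<le> c + of_int k * T" "c + of_int k * T < t + T"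
    using translate_into_period[OF T_pos] .
  \<comment> \<open>These are two consecutive periodic copies of a time spent on the left, one on
    each side of \<open>t\<close>; they bound the excursion.\<close>
  have xc: "x (c + of_int k * T) < 0" "x (c + of_int (k - 1) * T) < 0"
    using c x_periodic_int by metis+
  then have "t \<noteq> c + of_int k * T" using assms by auto
  with k xc show thesis
    using nonzero_component[OF cont_x assms, of "c + of_int (k - 1) * T" "c + of_int k * T"] that
    by (auto simp: algebra_simps)
qed

end

text \<open>On \<open>x = 0\<close> the left field has \<open>x' = \<alpha> (y - l)\<close> and the
  right one \<open>x' = \<beta> (y - r)\<close>. Only the consequences for one orbit are recorded:
  reflection of arc ends in the folds, the sign of \<open>x'\<close> at the start of an arc, and
  crossing where the two signs agree. No field is mentioned, so the symmetries below yield further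
  instances. \<open>long_arc\<close> asks for a right arc reaching beyond both folds.\<close>

locale crossing_orbit = closed_curve x y T for x y :: "real \<Rightarrow> real" and T +
  fixes \<alpha> \<beta> l r :: real
  assumes right_arc: "s < t \<Longrightarrow> x s = 0 \<Longrightarrow> x t = 0 \<Longrightarrow> (\<And>q. s < q \<Longrightarrow> q < t \<Longrightarrow> x q > 0) \<Longrightarrow>
      y s + y t = 2 * r \<and> \<beta> * (y s - r) \<ge> 0"
    and left_arc: "s < t \<Longrightarrow> x s = 0 \<Longrightarrow> x t = 0 \<Longrightarrow> (\<And>q. s < q \<Longrightarrow> q < t \<Longrightarrow> x q < 0) \<Longrightarrow>
      y s + y t = 2 * l \<and> \<alpha> * (y s - l) \<le> 0"
    and crossing_right: "x s = 0 \<Longrightarrow> \<alpha> * (y s - l) > 0 \<Longrightarrow> \<beta> * (y s - r) > 0 \<Longrightarrow>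
      \<exists>\<delta>>0. (\<forall>t. s - \<delta> < t \<and> t < s \<longrightarrow> x t < 0) \<and> (\<forall>t. s < t \<and> t < s + \<delta> \<longrightarrow> x t > 0)"
    and crossing_left: "x s = 0 \<Longrightarrow> \<alpha> * (y s - l) < 0 \<Longrightarrow> \<beta> * (y s - r) < 0 \<Longrightarrow>
      \<exists>\<delta>>0. (\<forall>t. s - \<delta> < t \<and> t < s \<longrightarrow> x t > 0) \<and> (\<forall>t. s < t \<and> t < s + \<delta> \<longrightarrow> x t < 0)"
    and long_arc: "\<exists>s t. s < t \<and> x s = 0 \<and> x t = 0 \<and> (\<forall>q. s < q \<and> q < t \<longrightarrow> x q > 0) \<and>
      \<bar>y s - r\<bar> > \<bar>r - l\<bar>"
begin

text \<open>Reversal negates \<open>x'\<close> and fixes the line pointwise, so the slopes change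
  sign and the folds stay. The two ends of an arc swap roles; since they are reflections of each
  other, the sign condition at one end becomes the opposite condition at the other.\<close>

lemma reverse_time: "crossing_orbit (\<lambda>t. x (- t)) (\<lambda>t. y (- t)) T (- \<alpha>) (- \<beta>) l r"
proof unfold_locales
  show "T > 0" by (rule T_pos)
  show "continuous_on UNIV (\<lambda>t. x (- t))" "continuous_on UNIV (\<lambda>t. y (- t))"
    by (auto intro!: continuous_intros continuous_on_compose2[OF cont_x] continuous_on_compose2[OF cont_y])
  show "x (- (t + T)) = x (- t)" "y (- (t + T)) = y (- t)" for t
    using periodic[of "- (t + T)"] by simp_all
  show "\<exists>k::int. t = s + of_int k * T" if "x (- s) = x (- t)" "y (- s) = y (- t)" for s t
  proof -
    from simple[OF that] obtain k :: int where "- t = - s + of_int k * T" by blast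
    then show ?thesis by (intro exI[of _ "- k"]) simp
  qed
  show "y (- s) + y (- t) = 2 * r \<and> - \<beta> * (y (- s) - r) \<ge> 0"
    if "s < t" "x (- s) = 0" "x (- t) = 0" and arc: "\<And>q. s < q \<Longrightarrow> q < t \<Longrightarrow> x (- q) > 0" for s t
  proof -
    have "y (- t) + y (- s) = 2 * r \<and> \<beta> * (y (- t) - r) \<ge> 0"
      using that(1-3) arc[of "- q" for q] by (intro right_arc) auto
    moreover from this have "y (- s) - r = - (y (- t) - r)" by linarith
    ultimately show ?thesis by (simp del: minus_diff_eq)
  qed
  show "y (- s) + y (- t) = 2 * l \<and> - \<alpha> * (y (- s) - l) \<le> 0"
    if "s < t" "x (- s) = 0" "x (- t) = 0" and arc: "\<And>q. s < q \<Longrightarrow> q < t \<Longrightarrow> x (- q) < 0" for s t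
  proof -
    have "y (- t) + y (- s) = 2 * l \<and> \<alpha> * (y (- t) - l) \<le> 0"
      using that(1-3) arc[of "- q" for q] by (intro left_arc) auto
    moreover from this have "y (- s) - l = - (y (- t) - l)" by linarith
    ultimately show ?thesis by (simp del: minus_diff_eq)
  qed
  show "\<exists>\<delta>>0. (\<forall>t. s - \<delta> < t \<and> t < s \<longrightarrow> x (- t) < 0) \<and> (\<forall>t. s < t \<and> t < s + \<delta> \<longrightarrow> x (- t) > 0)"
    if "x (- s) = 0" "- \<alpha> * (y (- s) - l) > 0" "- \<beta> * (y (- s) - r) > 0" for s
  proof -
    have "\<alpha> * (y (- s) - l) < 0" "\<beta> * (y (- s) - r) < 0" using that by auto
    from crossing_left[OF that(1) this] obtain \<delta> where
      "\<delta> > 0" "\<And>t. - s - \<delta> < t \<Longrightarrow> t < - s \<Longrightarrow> x t > 0" "\<And>t. - s < t \<Longrightarrow> t < - s + \<delta> \<Longrightarrow> x t < 0"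
      by blast
    then show ?thesis by (intro exI[of _ \<delta>]) auto
  qed
  show "\<exists>\<delta>>0. (\<forall>t. s - \<delta> < t \<and> t < s \<longrightarrow> x (- t) > 0) \<and> (\<forall>t. s < t \<and> t < s + \<delta> \<longrightarrow> x (- t) < 0)"
    if "x (- s) = 0" "- \<alpha> * (y (- s) - l) < 0" "- \<beta> * (y (- s) - r) < 0" for s
  proof -
    have "\<alpha> * (y (- s) - l) > 0" "\<beta> * (y (- s) - r) > 0" using that by auto
    from crossing_right[OF that(1) this] obtain \<delta> where
      "\<delta> > 0" "\<And>t. - s - \<delta> < t \<Longrightarrow> t < - s \<Longrightarrow> x t < 0" "\<And>t. - s < t \<Longrightarrow> t < - s + \<delta> \<Longrightarrow> x t > 0"
      by blast
    then show ?thesis by (intro exI[of _ \<delta>]) auto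
  qed
  show "\<exists>t. x (- t) < 0" using visits_left by (metis minus_minus)
  from long_arc obtain s t where st: "s < t" "x s = 0" "x t = 0"
    "\<And>q. s < q \<Longrightarrow> q < t \<Longrightarrow> x q > 0" "\<bar>y s - r\<bar> > \<bar>r - l\<bar>" by blast
  have "y s + y t = 2 * r" using right_arc[OF st(1-4)] by blast
  with st show "\<exists>s t. s < t \<and> x (- s) = 0 \<and> x (- t) = 0 \<and> (\<forall>q. s < q \<and> q < t \<longrightarrow> x (- q) > 0) \<and>
      \<bar>y (- s) - r\<bar> > \<bar>r - l\<bar>"
    by (intro exI[of _ "- t"] exI[of _ "- s"]) auto
qed

text \<open>Flipping \<open>y\<close> leaves \<open>x'\<close> unchanged, so the products of slope
  and distance to the fold are preserved while slopes and folds are both negated.\<close>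

lemma reflect: "crossing_orbit x (\<lambda>t. - y t) T (- \<alpha>) (- \<beta>) (- l) (- r)"
proof unfold_locales
  have eq: "- \<alpha> * (- y s - - l) = \<alpha> * (y s - l)" "- \<beta> * (- y s - - r) = \<beta> * (y s - r)" for s
    by (simp_all add: algebra_simps)
  show "T > 0" "continuous_on UNIV x" "x (t + T) = x t" "\<exists>t. x t < 0" for t
    by (fact T_pos cont_x periodic visits_left)+
  show "continuous_on UNIV (\<lambda>t. - y t)" by (intro continuous_intros cont_y)
  show "- y (t + T) = - y t" for t using periodic by simp
  show "\<exists>k::int. t = s + of_int k * T" if "x s = x t" "- y s = - y t" for s t
    using simple[of s t] that by simp
  show "- y s + - y t = 2 * - r \<and> - \<beta> * (- y s - - r) \<ge> 0"
    if "s < t" "x s = 0" "x t = 0" "\<And>q. s < q \<Longrightarrow> q < t \<Longrightarrow> x q > 0" for s t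
    using right_arc[OF that] unfolding eq by simp
  show "- y s + - y t = 2 * - l \<and> - \<alpha> * (- y s - - l) \<le> 0"
    if "s < t" "x s = 0" "x t = 0" "\<And>q. s < q \<Longrightarrow> q < t \<Longrightarrow> x q < 0" for s t
    using left_arc[OF that] unfolding eq by simp
  show "\<exists>\<delta>>0. (\<forall>t. s - \<delta> < t \<and> t < s \<longrightarrow> x t < 0) \<and> (\<forall>t. s < t \<and> t < s + \<delta> \<longrightarrow> x t > 0)"
    if "x s = 0" "- \<alpha> * (- y s - - l) > 0" "- \<beta> * (- y s - - r) > 0" for s
    using crossing_right that unfolding eq by blast
  show "\<exists>\<delta>>0. (\<forall>t. s - \<delta> < t \<and> t < s \<longrightarrow> x t > 0) \<and> (\<forall>t. s < t \<and> t < s + \<delta> \<longrightarrow> x t < 0)"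
    if "x s = 0" "- \<alpha> * (- y s - - l) < 0" "- \<beta> * (- y s - - r) < 0" for s
    using crossing_left that unfolding eq by blast
  have "\<bar>- y s - - r\<bar> = \<bar>y s - r\<bar>" "\<bar>- r - - l\<bar> = \<bar>r - l\<bar>" for s by linarith+
  then show "\<exists>s t. s < t \<and> x s = 0 \<and> x t = 0 \<and> (\<forall>q. s < q \<and> q < t \<longrightarrow> x q > 0) \<and>
      \<bar>- y s - - r\<bar> > \<bar>- r - - l\<bar>"
    using long_arc by metis
qed

lemma visits_right: "\<exists>t. x t > 0"
proof -
  from long_arc obtain s t where "s < t" "\<And>q. s < q \<Longrightarrow> q < t \<Longrightarrow> x q > 0" by blast
  then have "x ((s + t) / 2) > 0" by auto
  then show ?thesis by blast
qed

lemma left_arcE: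
  assumes "x t < 0"
  obtains s u where "s < t" "t < u" "x s = 0" "x u = 0" "\<And>q. s < q \<Longrightarrow> q < u \<Longrightarrow> x q < 0"
proof -
  from visits_right obtain c where c: "x c > 0" by blast
  obtain k :: int where k: "t \<le> c + of_int k * T" "c + of_int k * T < t + T"
    using translate_into_period[OF T_pos] .
  have xc: "x (c + of_int k * T) > 0" "x (c + of_int (k - 1) * T) > 0"
    using c x_periodic_int by metis+
  then have "t \<noteq> c + of_int k * T" using assms by auto
  with k xc assms show thesis
    using nonzero_component[of "\<lambda>t. - x t" t "c + of_int (k - 1) * T" "c + of_int k * T"] that
    by (auto simp: algebra_simps intro: continuous_intros cont_x)
qed

text \<open>Far out, both half-return maps cross the line, and their composition is the translation
  \<open>y \<mapsto> y + 2 (r - l)\<close>, so the largest distance of the orbit on the line from \<open>l\<close> cannot be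
  attained.\<close>

lemma not_spiralling:
  assumes "\<alpha> < 0" "\<beta> < 0" "l < r"
  shows False
proof -
  let ?Z = "{t. x t = 0} \<inter> {0..T}"
  from long_arc obtain s t where st: "s < t" "x s = 0" "x t = 0"
    "\<And>q. s < q \<Longrightarrow> q < t \<Longrightarrow> x q > 0" "\<bar>y s - r\<bar> > \<bar>r - l\<bar>" by blast
  have "closed ?Z"
    by (intro closed_Int closed_Collect_eq continuous_intros cont_x closed_atLeastAtMost)
  then have "compact ?Z" by (auto intro!: compact_eq_bounded_closed[THEN iffD2] bounded_Int)
  have into: "\<exists>k::int. q + of_int k * T \<in> {0..T}" for q
    using translate_into_period[OF T_pos, of 0 q] by (metis add_0 atLeastAtMost_iff less_imp_le)
  obtain k :: int where "s + of_int k * T \<in> ?Z" using into[of s] st(2) x_periodic_int[of s] by auto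
  then have "?Z \<noteq> {}" by blast
  moreover have "continuous_on ?Z (\<lambda>t. \<bar>y t - l\<bar>)"
    by (intro continuous_intros continuous_on_subset[OF cont_y]) auto
  ultimately obtain p where p: "x p = 0" "\<And>q. q \<in> ?Z \<Longrightarrow> \<bar>y q - l\<bar> \<le> \<bar>y p - l\<bar>"
    using continuous_attains_sup[OF \<open>compact ?Z\<close>] by blast
  \<comment> \<open>The maximum over one period bounds all visits to the line, by
    periodicity.\<close>
  have p_max: "\<bar>y q - l\<bar> \<le> \<bar>y p - l\<bar>" if "x q = 0" for q
    using into[of q] p(2) that x_periodic_int y_periodic_int by (metis (mono_tags, lifting) IntI mem_Collect_eq)
  \<comment> \<open>The long arc starts below \<open>r\<close> and ends above it at the same
    distance, which exceeds \<open>r - l\<close>.\<close>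
  have far: "\<bar>y p - l\<bar> > r - l"
  proof -
    have "y s + y t = 2 * r" "\<beta> * (y s - r) \<ge> 0" using right_arc[OF st(1-4)] by auto
    moreover from this assms(2) have "y s \<le> r" by (simp add: zero_le_mult_iff)
    ultimately have "\<bar>y t - l\<bar> > r - l" using st(5) assms(3) by linarith
    with p_max[OF st(3)] show ?thesis by linarith
  qed
  \<comment> \<open>A point of the orbit below \<open>l\<close> at the maximal distance: either
    \<open>p\<close> itself, or the end of the left arc that starts at \<open>p\<close>.\<close>
  obtain p' where p': "x p' = 0" "y p' = l - \<bar>y p - l\<bar>"
  proof (cases "y p \<le> l")
    case True
    with p that[of p] show thesis by auto
  next
    case False
    with far have "y p > r" by linarith
    then have "\<alpha> * (y p - l) < 0" "\<beta> * (y p - r) < 0" using False assms by (auto simp: mult_less_0_iff)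
    from crossing_left[OF p(1) this] obtain \<delta> where
      \<delta>: "\<delta> > 0" "\<And>t. p < t \<Longrightarrow> t < p + \<delta> \<Longrightarrow> x t < 0" by blast
    then have "x (p + \<delta> / 2) < 0" by simp
    then obtain s u where su: "s < p + \<delta> / 2" "p + \<delta> / 2 < u" "x s = 0" "x u = 0"
      "\<And>q. s < q \<Longrightarrow> q < u \<Longrightarrow> x q < 0" using left_arcE by blast
    then have "s = p" using \<delta>(1) \<delta>(2)[of s] su(5)[of p] p(1) by (cases s p rule: linorder_cases) auto
    then have "y p + y u = 2 * l" using left_arc[of s u] su by auto
    with su(4) False that[of u] show thesis by simp
  qed
  have "y p' < l" "y p' < r" using p' far assms by linarith+
  then have "\<alpha> * (y p' - l) > 0" "\<beta> * (y p' - r) > 0" using assms by (auto simp: zero_less_mult_iff)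
  from crossing_right[OF p'(1) this] obtain \<delta> where
    \<delta>: "\<delta> > 0" "\<And>t. p' < t \<Longrightarrow> t < p' + \<delta> \<Longrightarrow> x t > 0" by blast
  then have "x (p' + \<delta> / 2) > 0" by simp
  then obtain s u where su: "s < p' + \<delta> / 2" "p' + \<delta> / 2 < u" "x s = 0" "x u = 0"
    "\<And>q. s < q \<Longrightarrow> q < u \<Longrightarrow> x q > 0" using right_arcE by blast
  then have "s = p'" using \<delta>(1) \<delta>(2)[of s] su(5)[of p'] p'(1) by (cases s p' rule: linorder_cases) auto
  \<comment> \<open>The right arc from \<open>p'\<close> ends at distance
    \<open>\<bar>y p - l\<bar> + 2 * (r - l)\<close> above \<open>l\<close>, beyond the
    maximum.\<close>
  then have "y p' + y u = 2 * r" using right_arc[of s u] su by auto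
  then show False using p_max[OF su(4)] p'(2) assms(3) by linarith
qed

text \<open>Below the folds the line is an attracting sliding segment. The orbit lands there once from the
  right and once from the left, and the landing at the lower point slides up through the other
  landing point, so the orbit is not a simple curve.\<close>

lemma not_sliding:
  assumes "\<alpha> < 0" "0 < \<beta>" "l \<le> r"
  shows False
proof -
  \<comment> \<open>Departure is possible only at the start of an arc. With these signs right arcs
    start at height at least \<open>r\<close> and left arcs at height at least \<open>l\<close>, so
    below \<open>l\<close> the orbit is trapped on the line.\<close>
  have stays: "x t = 0" if "x s = 0" "s \<le> t" and below: "\<And>q. s \<le> q \<Longrightarrow> q \<le> t \<Longrightarrow> y q < l" for s t
  proof (rule ccontr)
    assume "x t \<noteq> 0"
    then consider "x t > 0" | "x t < 0" by linarith
    then show False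
    proof cases
      case 1
      then obtain p u where pu: "p < t" "t < u" "x p = 0" "x u = 0" "\<And>q. p < q \<Longrightarrow> q < u \<Longrightarrow> x q > 0"
        using right_arcE by blast
      have "s \<le> p" using pu(2) pu(5)[of s] that by (cases "s \<le> p") auto
      then have "y p < r" using below[of p] pu assms by auto
      moreover have "\<beta> * (y p - r) \<ge> 0" using right_arc[of p u] pu by auto
      ultimately show False using assms by (simp add: zero_le_mult_iff)
    next
      case 2
      then obtain p u where pu: "p < t" "t < u" "x p = 0" "x u = 0" "\<And>q. p < q \<Longrightarrow> q < u \<Longrightarrow> x q < 0"
        using left_arcE by blast
      have "s \<le> p" using pu(2) pu(5)[of s] that by (cases "s \<le> p") auto
      then have "y p < l" using below[of p] pu by auto
      moreover have "\<alpha> * (y p - l) \<le> 0" using left_arc[of p u] pu by auto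
      ultimately show False using assms by (simp add: mult_le_0_iff)
    qed
  qed
  \<comment> \<open>The orbit must return to \<open>x < 0\<close>, so by \<open>stays\<close> it has
    to climb to height \<open>l\<close>, passing \<open>\<eta>\<close> on the way. Up to the first
    time \<open>q\<close> at height \<open>\<eta>\<close> it is below \<open>l\<close>, hence on the
    line.\<close>
  have slides: "\<exists>q\<ge>s. y q = \<eta> \<and> (\<forall>p. s \<le> p \<and> p \<le> q \<longrightarrow> x p = 0)"
    if s: "x s = 0" and \<eta>: "y s \<le> \<eta>" "\<eta> < l" for s \<eta>
  proof -
    from visits_left obtain c0 where "x c0 < 0" by blast
    then obtain c where c: "s \<le> c" "x c < 0"
      using translate_into_period[OF T_pos, of s c0] x_periodic_int by metis
    have "\<exists>q. s \<le> q \<and> q \<le> c \<and> y q \<ge> l" using stays[OF s c(1)] c(2) by force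
    then obtain b where b: "s \<le> b" "y b \<ge> l" by blast
    have ivt: "\<exists>q. s \<le> q \<and> q \<le> b' \<and> y q = \<eta>" if "s \<le> b'" "y b' \<ge> \<eta>" for b'
      using IVT'[of y s \<eta> b'] that \<eta> continuous_on_subset[OF cont_y] by auto
    let ?K = "{q. y q = \<eta>} \<inter> {s..b}"
    have "closed ?K"
      by (intro closed_Int closed_Collect_eq continuous_intros cont_y closed_atLeastAtMost)
    then have "compact ?K" by (auto intro!: compact_eq_bounded_closed[THEN iffD2] bounded_Int)
    moreover have "?K \<noteq> {}" using ivt[OF b(1)] b \<eta> by auto
    ultimately obtain q where q: "y q = \<eta>" "s \<le> q" "q \<le> b" "\<And>p. p \<in> ?K \<Longrightarrow> q \<le> p"
      using compact_attains_inf by (metis (mono_tags, lifting) IntE atLeastAtMost_iff mem_Collect_eq)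
    have le: "y p \<le> \<eta>" if p: "s \<le> p" "p \<le> q" for p
    proof (rule ccontr)
      assume "\<not> y p \<le> \<eta>"
      then obtain p' where "s \<le> p'" "p' \<le> p" "y p' = \<eta>" using ivt[of p] p by auto
      moreover from this have "q \<le> p'" using q p by auto
      ultimately have "p' = p" using p by simp
      with \<open>y p' = \<eta>\<close> \<open>\<not> y p \<le> \<eta>\<close> show False by simp
    qed
    have "x p = 0" if "s \<le> p" "p \<le> q" for p
      using stays[OF s that(1)] le that \<eta> by (meson dual_order.trans le_less_trans)
    with q show ?thesis by blast
  qed
  from long_arc obtain s t where R: "s < t" "x s = 0" "x t = 0"
    "\<And>q. s < q \<Longrightarrow> q < t \<Longrightarrow> x q > 0" "\<bar>y s - r\<bar> > \<bar>r - l\<bar>" by blast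
  have "y s + y t = 2 * r" "\<beta> * (y s - r) \<ge> 0" using right_arc[OF R(1-4)] by auto
  moreover from this assms have "y s \<ge> r" by (simp add: zero_le_mult_iff)
  \<comment> \<open>The landing point of the long right arc is
    \<open>r - \<bar>y s - r\<bar>\<close>, and this is less than \<open>l\<close>.\<close>
  ultimately have yt: "y t < l" using R(5) assms(3) by linarith
  from visits_left obtain c where "x c < 0" by blast
  then obtain s' t' where L: "s' < c" "c < t'" "x s' = 0" "x t' = 0"
    "\<And>q. s' < q \<Longrightarrow> q < t' \<Longrightarrow> x q < 0" using left_arcE by blast
  have ys': "y s' + y t' = 2 * l" "\<alpha> * (y s' - l) \<le> 0" using left_arc[of s' t'] L by auto
  then have "y s' \<ge> l" using assms by (simp add: mult_le_0_iff)
  \<comment> \<open>Otherwise both ends of the left arc are the fold, so the arc is already a closed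
    curve and fills a whole period on the left, contradicting \<open>visits_right\<close>.\<close>
  have "y t' \<noteq> l"
  proof
    assume "y t' = l"
    then obtain k :: int where k: "t' = s' + of_int k * T" using simple[of s' t'] L ys' by auto
    then have "0 < of_int k * T" using L by auto
    then have "k \<ge> 1" using T_pos by (simp add: zero_less_mult_iff)
    then have "1 * T \<le> of_int k * T" using T_pos by (intro mult_right_mono) auto
    from visits_right obtain c' where "x c' > 0" by blast
    then obtain j :: int where j: "s' \<le> c' + of_int j * T" "c' + of_int j * T < s' + T"
      "x (c' + of_int j * T) > 0" using translate_into_period[OF T_pos, of s' c'] x_periodic_int by metis
    then have "s' \<noteq> c' + of_int j * T" using L by auto
    with j k L(5)[of "c' + of_int j * T"] \<open>1 * T \<le> _\<close> show False by auto
  qed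
  with \<open>y s' \<ge> l\<close> ys' have yt': "y t' < l" by linarith
  show False
  \<comment> \<open>The orbit slides from the lower landing point to the upper one. There it arrives
    a second time, and the two histories just before arrival lie on different sides of the
    line.\<close>
  proof (cases "y t \<le> y t'")
    case True
    then obtain q where q: "q \<ge> t" "y q = y t'" "\<And>p. t \<le> p \<Longrightarrow> p \<le> q \<Longrightarrow> x p = 0"
      using slides[OF R(3) True yt'] by blast
    then obtain k :: int where k: "t' = q + of_int k * T" using simple[of q t'] L by auto
    \<comment> \<open>After \<open>p'\<close> the history ending at \<open>q\<close> is still the
      right arc or the slide, so \<open>x \<ge> 0\<close>, while its shift by
      \<open>of_int k * T\<close> is still inside the left arc, so \<open>x < 0\<close>.\<close>
    define p' where "p' = max s (s' - of_int k * T)"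
    have "p' < q" using R q(1) L k unfolding p'_def by auto
    define m where "m = (p' + q) / 2"
    have m: "p' < m" "m < q" using \<open>p' < q\<close> unfolding m_def by auto
    then have "x (m + of_int k * T) < 0" using L(5)[of "m + of_int k * T"] k unfolding p'_def by auto
    then have "x m < 0" using x_periodic_int by metis
    moreover have "x m \<ge> 0" using q(3)[of m] R(4)[of m] m unfolding p'_def by (cases "m < t") auto
    ultimately show False by simp
  next
    case False
    then obtain q where q: "q \<ge> t'" "y q = y t" "\<And>p. t' \<le> p \<Longrightarrow> p \<le> q \<Longrightarrow> x p = 0"
      using slides[OF L(4) _ yt] by force
    then obtain k :: int where k: "t = q + of_int k * T" using simple[of q t] R by auto
    define p' where "p' = max s' (s - of_int k * T)"
    have "p' < q" using R q(1) L k unfolding p'_def by auto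
    define m where "m = (p' + q) / 2"
    have m: "p' < m" "m < q" using \<open>p' < q\<close> unfolding m_def by auto
    then have "x (m + of_int k * T) > 0" using R(4)[of "m + of_int k * T"] k unfolding p'_def by auto
    then have "x m > 0" using x_periodic_int by metis
    moreover have "x m \<le> 0" using q(3)[of m] L(5)[of m] m unfolding p'_def by (cases "m < t'") auto
    ultimately show False by simp
  qed
qed

text \<open>The two exclusions, transported by time reversal, reflection and their composition, rule
  out equal signs with \<open>l \<noteq> r\<close> in either order and opposite signs in every
  position of the folds.\<close>

lemma same_direction_same_fold:
  assumes "\<alpha> \<noteq> 0" "\<beta> \<noteq> 0"
  shows "\<alpha> * \<beta> > 0 \<and> l = r"
proof -
  interpret rev: crossing_orbit "\<lambda>t. x (- t)" "\<lambda>t. y (- t)" T "- \<alpha>" "- \<beta>" l r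
    by (rule reverse_time)
  interpret ref: crossing_orbit x "\<lambda>t. - y t" T "- \<alpha>" "- \<beta>" "- l" "- r"
    by (rule reflect)
  interpret both: crossing_orbit "\<lambda>t. x (- t)" "\<lambda>t. - y (- t)" T \<alpha> \<beta> "- l" "- r"
    using rev.reflect by simp
  note impossible = not_spiralling not_sliding rev.not_spiralling rev.not_sliding
    ref.not_spiralling ref.not_sliding both.not_spiralling both.not_sliding
  show ?thesis
    using impossible assms
    by (cases "\<alpha> < 0"; cases "\<beta> < 0"; cases l r rule: linorder_cases)
       (auto simp: zero_less_mult_iff)
qed

end

section \<open>Linear centers\<close>

text \<open>\<open>exp (- k * t) * f t\<close> is constant, yet over a period its exponential factor
  changes while \<open>f\<close> does not.\<close>

lemma periodic_exponential_zero:
  fixes f :: "real \<Rightarrow> real"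
  assumes der: "\<And>t. (f has_real_derivative k * f t) (at t)"
    and per: "f (t + T) = f t" and "T \<noteq> 0" "k \<noteq> 0"
  shows "f t = 0"
proof -
  define h where "h = (\<lambda>t. exp (- k * t) * f t)"
  have "(h has_real_derivative 0) (at t)" for t
    unfolding h_def by (auto intro!: derivative_eq_intros der simp: algebra_simps)
  then have "h (t + T) = h t"
    by (intro DERIV_isconst_all) blast
  then have "exp (- k * (t + T)) * f t = exp (- k * t) * f t"
    by (simp add: h_def per)
  then show ?thesis using assms(3,4) by (auto simp: algebra_simps)
qed

lemma mono_periodic_const:
  fixes f :: "real \<Rightarrow> real"
  assumes "mono f" and per: "\<And>t. f (t + T) = f t" and "T > 0"
  shows "f s = f t"
proof -
  have "f s \<le> f t" for s t
  proof -
    obtain n :: nat where "(s - t) / T < of_nat n" using reals_Archimedean2 by blast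
    then have "s \<le> t + of_nat n * T" using \<open>T > 0\<close> by (simp add: field_simps)
    then show ?thesis using monoD[OF \<open>mono f\<close>] periodic_int[of f T t "int n"] per by fastforce
  qed
  then show ?thesis by (simp add: antisym)
qed

text \<open>For the flow \<open>w' = M w\<close> the determinant of \<open>w\<close> and \<open>M w\<close> satisfies \<open>q' = tr M q\<close>.\<close>

lemma periodic_linear_wronskian:
  fixes x y :: "real \<Rightarrow> real"
  assumes x: "\<And>t. (x has_real_derivative a * x t + b * y t) (at t)"
    and y: "\<And>t. (y has_real_derivative c * x t + d * y t) (at t)"
    and per: "x (t + T) = x t" "y (t + T) = y t" and "T \<noteq> 0" "a + d \<noteq> 0"
  shows "c * (x t)\<^sup>2 + (d - a) * x t * y t - b * (y t)\<^sup>2 = 0"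
proof (rule periodic_exponential_zero
    [where f = "\<lambda>t. c * (x t)\<^sup>2 + (d - a) * x t * y t - b * (y t)\<^sup>2" and k = "a + d" and T = T])
  show "((\<lambda>t. c * (x t)\<^sup>2 + (d - a) * x t * y t - b * (y t)\<^sup>2) has_real_derivative
      (a + d) * (c * (x t)\<^sup>2 + (d - a) * x t * y t - b * (y t)\<^sup>2)) (at t)" for t
    by (auto intro!: derivative_eq_intros x y simp: algebra_simps power2_eq_square)
qed (use assms in auto)

text \<open>For \<open>w' = M w\<close> let \<open>P\<close> be the inner product of
  \<open>w\<close> and \<open>M w\<close>. Tracelessness makes the square of \<open>M\<close> equal
  to \<open>a\<^sup>2 + b * c\<close> times the identity, so \<open>P'\<close> is the squared norm
  of \<open>M w\<close> plus that number times the squared norm of \<open>w\<close>. If the number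
  were nonnegative, \<open>P\<close> would be monotone and periodic, hence constant; then
  \<open>M w = 0\<close> and the orbit is at rest.\<close>

lemma periodic_traceless_det_pos:
  fixes x y :: "real \<Rightarrow> real"
  assumes x: "\<And>t. (x has_real_derivative a * x t + b * y t) (at t)"
    and y: "\<And>t. (y has_real_derivative c * x t - a * y t) (at t)"
    and per: "\<And>t. x (t + T) = x t" "\<And>t. y (t + T) = y t" and "T > 0"
    and moving: "x s \<noteq> x t \<or> y s \<noteq> y t"
  shows "a\<^sup>2 + b * c < 0"
proof (rule ccontr)
  assume neg: "\<not> a\<^sup>2 + b * c < 0"
  define P where "P = (\<lambda>t. x t * (a * x t + b * y t) + y t * (c * x t - a * y t))"
  define P' where "P' = (\<lambda>t. (a * x t + b * y t)\<^sup>2 + (c * x t - a * y t)\<^sup>2 +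
    (a\<^sup>2 + b * c) * ((x t)\<^sup>2 + (y t)\<^sup>2))"
  have P: "(P has_real_derivative P' t) (at t)" for t
    unfolding P_def P'_def
    by (auto intro!: derivative_eq_intros x y simp: algebra_simps power2_eq_square)
  have P'_nonneg: "P' t \<ge> 0" for t
    unfolding P'_def using neg mult_nonneg_nonneg[of "a\<^sup>2 + b * c" "(x t)\<^sup>2 + (y t)\<^sup>2"]
    by (simp add: add_nonneg_nonneg)
  have "mono P"
    using DERIV_nonneg_imp_nondecreasing P P'_nonneg by (intro monoI) blast
  then have "P s = P t" for s t
    by (rule mono_periodic_const) (use per \<open>T > 0\<close> in \<open>auto simp: P_def\<close>)
  then have "P = (\<lambda>_. P 0)" by (intro ext) blast
  moreover have "((\<lambda>_. P 0) has_real_derivative 0) (at t)" for t by simp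
  ultimately have "P' t = 0" for t
    using DERIV_unique[OF P] by fastforce
  moreover have "(a\<^sup>2 + b * c) * ((x t)\<^sup>2 + (y t)\<^sup>2) \<ge> 0" for t using neg by simp
  ultimately have "(a * x t + b * y t)\<^sup>2 + (c * x t - a * y t)\<^sup>2 \<le> 0" for t
    unfolding P'_def by (smt (verit, best))
  then have "a * x t + b * y t = 0" "c * x t - a * y t = 0" for t
    by (simp_all add: sum_power2_le_zero_iff)
  with x y have "(x has_real_derivative 0) (at t)" "(y has_real_derivative 0) (at t)" for t by metis+
  then have "x s = x t" "y s = y t"
    using DERIV_isconst_all by blast+
  with moving show False by simp
qed

section \<open>Regularity of solutions of the differential inclusion\<close>

lemma solution_integral:
  assumes "solution F g"
  shows "\<exists>N v. negligible N \<and> (\<forall>t. t \<notin> N \<longrightarrow> v t \<in> F (g t)) \<and>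
    (\<forall>s t. s \<le> t \<longrightarrow> (v has_integral (g t - g s)) {s..t})"
proof -
  from assms obtain v where v: "\<And>s t. s \<le> t \<Longrightarrow> (v has_integral (g t - g s)) {s..t}"
    and ae: "AE t in lebesgue. v t \<in> F (g t)" unfolding solution_def by blast
  from ae obtain N where "negligible N" "{t. v t \<notin> F (g t)} \<subseteq> N"
    unfolding negligible_iff_null_sets by (auto simp: eventually_ae_filter)
  then show ?thesis using v by (intro exI[of _ N] exI[of _ v]) auto
qed

lemma solution_continuous:
  assumes "solution F g"
  shows "continuous_on UNIV g"
proof -
  obtain N v where "negligible N" "\<And>t. t \<notin> N \<Longrightarrow> v t \<in> F (g t)"
    and v: "\<And>s t. s \<le> t \<Longrightarrow> (v has_integral (g t - g s)) {s..t}"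
    using solution_integral[OF assms] by auto
  have "continuous (at t) g" for t
  proof -
    have "continuous_on {t - 1..t + 1} (\<lambda>q. g (t - 1) + integral {t - 1..q} v)"
      using v[of "t - 1" "t + 1"]
      by (intro continuous_intros indefinite_integral_continuous_1) auto
    also have "?this \<longleftrightarrow> continuous_on {t - 1..t + 1} g"
    proof (intro continuous_on_cong refl)
      fix q assume "q \<in> {t - 1..t + 1}"
      then have "integral {t - 1..q} v = g q - g (t - 1)"
        using v[of "t - 1" q] by (simp add: integral_unique)
      then show "g (t - 1) + integral {t - 1..q} v = g q" by simp
    qed
    finally show ?thesis by (auto simp: continuous_on_interior)
  qed
  then show ?thesis by (simp add: continuous_at_imp_continuous_on)
qed

text \<open>While the inclusion is single-valued, the integrand agrees with the continuous
  \<open>X (g q)\<close> off a null set, so the fundamental theorem of calculus applies, one-sidedly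
  at the ends.\<close>

lemma solution_has_vector_derivative:
  assumes sol: "solution F g" and X: "continuous_on UNIV X"
    and F: "\<And>q. s < q \<Longrightarrow> q < t \<Longrightarrow> F (g q) = {X (g q)}"
    and q: "q \<in> {s..t}"
  shows "(g has_vector_derivative X (g q)) (at q within {s..t})"
proof -
  obtain N v where N: "negligible N" "\<And>t. t \<notin> N \<Longrightarrow> v t \<in> F (g t)"
    and v: "\<And>s t. s \<le> t \<Longrightarrow> (v has_integral (g t - g s)) {s..t}"
    using solution_integral[OF sol] by auto
  have cont: "continuous_on {s..t} (\<lambda>q. X (g q))"
    using continuous_on_compose2[OF X continuous_on_subset[OF solution_continuous[OF sol]]] by auto
  have eq: "g s + integral {s..p} (\<lambda>q. X (g q)) = g p" if "p \<in> {s..t}" for p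
  proof -
    have "((\<lambda>q. X (g q)) has_integral (g p - g s)) {s..p}"
    proof (rule has_integral_spike)
      \<comment> \<open>The ends join the exceptional set because an arc may touch the switching
        line there, where the inclusion can be multivalued.\<close>
      show "negligible (N \<union> {s, t})" using N by simp
      show "X (g q) = v q" if "q \<in> {s..p} - (N \<union> {s, t})" for q
        using N(2)[of q] F[of q] that \<open>p \<in> {s..t}\<close> by auto
      show "(v has_integral (g p - g s)) {s..p}" using v that by auto
    qed
    then show ?thesis by (simp add: integral_unique)
  qed
  have "((\<lambda>p. g s + integral {s..p} (\<lambda>q. X (g q))) has_vector_derivative X (g q)) (at q within {s..t})"
    using integral_has_vector_derivative[OF cont q] by (auto intro!: derivative_eq_intros)
  then show ?thesis
    by (rule has_vector_derivative_transform[OF q, rotated]) (simp add: eq)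
qed

lemma ode_solution_has_vector_derivative:
  assumes "solution (ode_system X) g" "continuous_on UNIV X"
  shows "(g has_vector_derivative X (g t)) (at t)"
proof -
  have "(g has_vector_derivative X (g t)) (at t within {t - 1..t + 1})"
    by (rule solution_has_vector_derivative[OF assms]) (auto simp: ode_system_def)
  moreover have "at t within {t - 1..t + 1} = at t"
    by (rule at_within_interior) auto
  ultimately show ?thesis by simp
qed

lemma has_vector_derivative_component:
  fixes g :: "real \<Rightarrow> real^'n"
  assumes "(g has_vector_derivative g') (at t within S)"
  shows "((\<lambda>t. g t $ i) has_real_derivative g' $ i) (at t within S)"
  using bounded_linear.has_vector_derivative[OF bounded_linear_vec_nth assms]
  by (simp add: has_real_derivative_iff_has_vector_derivative)

lemma affine_field_component:
  "affine_field M u z $ i = M $ i $ 1 * z $ 1 + M $ i $ 2 * z $ 2 + u $ i"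
  by (simp add: affine_field_def matrix_vector_mult_def sum_2)

lemma continuous_affine_field: "continuous_on S (affine_field M u)"
  unfolding affine_field_def [abs_def]
  by (intro continuous_intros linear_continuous_on matrix_vector_mul_bounded_linear)

text \<open>Every point near \<open>p\<close> lies on a periodic orbit. With nonzero trace the
  quadratic form of \<open>periodic_linear_wronskian\<close> would vanish near the origin, so the
  matrix would be scalar and its orbits exponential. Once the trace is zero, a single periodic orbit
  decides the sign of the determinant.\<close>

lemma linear_center_traceless_det_pos:
  assumes "is_center (ode_system (affine_field M u)) p"
  shows "affine_field M u p = 0" "M $ 2 $ 2 = - M $ 1 $ 1"
    "(M $ 1 $ 1)\<^sup>2 + M $ 1 $ 2 * M $ 2 $ 1 < 0"
proof -
  from assms obtain U where p0: "affine_field M u p = 0" and U: "open U" "p \<in> U"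
    "U - {p} = \<Union>{C. periodic_orbit (ode_system (affine_field M u)) C \<and> C \<subseteq> U - {p}}"
    unfolding is_center_def singular_point_def ode_system_def by auto
  define a where "a = M $ 1 $ 1"
  define b where "b = M $ 1 $ 2"
  define c where "c = M $ 2 $ 1"
  define d where "d = M $ 2 $ 2"
  have p0': "a * p $ 1 + b * p $ 2 + u $ 1 = 0" "c * p $ 1 + d * p $ 2 + u $ 2 = 0"
    using arg_cong[OF p0, of "\<lambda>z. z $ 1"] arg_cong[OF p0, of "\<lambda>z. z $ 2"]
    by (simp_all add: affine_field_component a_def b_def c_def d_def)
  have orbit: "\<exists>x y T t0. x t0 = z $ 1 - p $ 1 \<and> y t0 = z $ 2 - p $ 2 \<and> T > 0 \<and>
      (\<forall>t. (x has_real_derivative a * x t + b * y t) (at t)) \<and>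
      (\<forall>t. (y has_real_derivative c * x t + d * y t) (at t)) \<and>
      (\<forall>t. x (t + T) = x t \<and> y (t + T) = y t) \<and> (x 0 \<noteq> x (T / 2) \<or> y 0 \<noteq> y (T / 2))"
    if z: "z \<in> U - {p}" for z
  proof -
    obtain C where "periodic_orbit (ode_system (affine_field M u)) C" "z \<in> C"
      using z U(3) by blast
    then obtain g T t0 where g: "T > 0" "solution (ode_system (affine_field M u)) g"
      "\<And>t. g (t + T) = g t" "inj_on g {0..<T}" "z = g t0"
      unfolding periodic_orbit_def by blast
    have der: "((\<lambda>t. g t $ i - p $ i) has_real_derivative affine_field M u (g t) $ i) (at t)" for t i
      using has_vector_derivative_component[OF ode_solution_has_vector_derivative[OF g(2) continuous_affine_field]]
      by (auto intro!: derivative_eq_intros)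
    have "g 0 \<noteq> g (T / 2)" using g(1,4) by (auto dest!: inj_onD)
    then have "g 0 $ 1 \<noteq> g (T / 2) $ 1 \<or> g 0 $ 2 \<noteq> g (T / 2) $ 2"
      by (auto simp: vec_eq_iff forall_2)
    moreover have "affine_field M u z $ 1 = a * (z $ 1 - p $ 1) + b * (z $ 2 - p $ 2)"
      "affine_field M u z $ 2 = c * (z $ 1 - p $ 1) + d * (z $ 2 - p $ 2)" for z
      using p0' by (simp_all add: affine_field_component a_def b_def c_def d_def algebra_simps)
    ultimately show ?thesis
      using der[of 1] der[of 2] g(1,3,5)
      by (intro exI[of _ "\<lambda>t. g t $ 1 - p $ 1"] exI[of _ "\<lambda>t. g t $ 2 - p $ 2"] exI[of _ T] exI[of _ t0]) auto
  qed
  from U obtain \<epsilon> where \<epsilon>: "\<epsilon> > 0" "ball p \<epsilon> \<subseteq> U" by (auto simp: open_contains_ball)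
  have near: "p + vector [\<xi>, \<eta>] \<in> U - {p}" if "\<bar>\<xi>\<bar> + \<bar>\<eta>\<bar> < \<epsilon>" "\<xi> \<noteq> 0 \<or> \<eta> \<noteq> 0" for \<xi> \<eta>
  proof -
    have "norm (vector [\<xi>, \<eta>] :: real^2) \<le> \<bar>\<xi>\<bar> + \<bar>\<eta>\<bar>"
      using norm_le_l1_cart[of "vector [\<xi>, \<eta>] :: real^2"] by (simp add: sum_2)
    then have "p + vector [\<xi>, \<eta>] \<in> ball p \<epsilon>" using that by (simp add: dist_norm)
    moreover have "vector [\<xi>, \<eta>] \<noteq> (0 :: real^2)" using that by (auto simp: vec_eq_iff forall_2)
    ultimately show ?thesis using \<epsilon> by auto
  qed
  have near_orbit: "\<exists>x y T t0. x t0 = \<xi> \<and> y t0 = \<eta> \<and> T > 0 \<and>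
      (\<forall>t. (x has_real_derivative a * x t + b * y t) (at t)) \<and>
      (\<forall>t. (y has_real_derivative c * x t + d * y t) (at t)) \<and>
      (\<forall>t. x (t + T) = x t \<and> y (t + T) = y t) \<and> (x 0 \<noteq> x (T / 2) \<or> y 0 \<noteq> y (T / 2))"
    if "\<bar>\<xi>\<bar> + \<bar>\<eta>\<bar> < \<epsilon>" "\<xi> \<noteq> 0 \<or> \<eta> \<noteq> 0" for \<xi> \<eta>
    using orbit[OF near[OF that]] by simp
  have half: "\<bar>\<epsilon> / 2\<bar> + \<bar>0\<bar> < \<epsilon>" "\<epsilon> / 2 \<noteq> 0 \<or> (0 :: real) \<noteq> 0" using \<epsilon>(1) by auto
  have tr: "a + d = 0"
  proof (rule ccontr)
    assume tr: "a + d \<noteq> 0"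
    have W: "c * \<xi>\<^sup>2 + (d - a) * \<xi> * \<eta> - b * \<eta>\<^sup>2 = 0"
      if small: "\<bar>\<xi>\<bar> + \<bar>\<eta>\<bar> < \<epsilon>" "\<xi> \<noteq> 0 \<or> \<eta> \<noteq> 0" for \<xi> \<eta>
    proof -
      obtain x y T t0 where *: "x t0 = \<xi>" "y t0 = \<eta>" "T > 0"
        "\<And>t. (x has_real_derivative a * x t + b * y t) (at t)"
        "\<And>t. (y has_real_derivative c * x t + d * y t) (at t)"
        "\<And>t. x (t + T) = x t" "\<And>t. y (t + T) = y t"
        using near_orbit[OF small] by blast
      show ?thesis
        using periodic_linear_wronskian[OF *(4,5) *(6,7)[of t0] _ tr] * by auto
    qed
    \<comment> \<open>Points on the two axes and on the diagonal isolate the three coefficients of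
      the form.\<close>
    have "c = 0" using W[of "\<epsilon> / 2" 0] \<epsilon> by simp
    moreover have "b = 0" using W[of 0 "\<epsilon> / 2"] \<epsilon> by simp
    ultimately have "d = a" using W[of "\<epsilon> / 3" "\<epsilon> / 3"] \<epsilon> by simp
    obtain x y :: "real \<Rightarrow> real" and T t0 where *: "x t0 = \<epsilon> / 2" "T > 0"
        "\<And>t. (x has_real_derivative a * x t + b * y t) (at t)" "\<And>t. x (t + T) = x t"
      using near_orbit[OF half] by blast
    have "x t0 = 0"
      by (rule periodic_exponential_zero[where f = x and k = a and T = T]) (use * tr \<open>b = 0\<close> \<open>d = a\<close> in auto)
    with * \<epsilon> show False by simp
  qed
  then have d: "d = - a" by simp
  obtain x y T where *: "T > 0"
      "\<And>t. (x has_real_derivative a * x t + b * y t) (at t)"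
      "\<And>t. (y has_real_derivative c * x t + d * y t) (at t)"
      "\<And>t. x (t + T) = x t" "\<And>t. y (t + T) = y t" "x 0 \<noteq> x (T / 2) \<or> y 0 \<noteq> y (T / 2)"
    using near_orbit[OF half] by blast
  have "a\<^sup>2 + b * c < 0"
    by (rule periodic_traceless_det_pos[of x a b y c T]) (use * d in auto)
  with p0 d show "affine_field M u p = 0" "M $ 2 $ 2 = - M $ 1 $ 1"
    "(M $ 1 $ 1)\<^sup>2 + M $ 1 $ 2 * M $ 2 $ 1 < 0" by (auto simp: a_def b_def c_def d_def)
qed

section \<open>Closed Filippov orbits\<close>

text \<open>The orbit enters \<open>x < 0\<close> because it surrounds \<open>p\<close>: otherwise
  the open left half-plane would lie in the component of \<open>p\<close> in the complement of
  \<open>C\<close>, which is bounded.\<close>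

lemma closed_curve_of_orbit:
  assumes "periodic_orbit F C" and p: "p \<in> inside C" "p $ 1 < 0"
  obtains g T where "solution F g" "C = range g"
    "closed_curve (\<lambda>t. g t $ 1) (\<lambda>t. g t $ 2) T"
proof -
  from assms obtain g T where g: "T > 0" "solution F g" "\<And>t. g (t + T) = g t"
    "inj_on g {0..<T}" "C = range g" unfolding periodic_orbit_def by blast
  have "closed_curve (\<lambda>t. g t $ 1) (\<lambda>t. g t $ 2) T"
  proof
    show "T > 0" "g (t + T) $ 1 = g t $ 1" "g (t + T) $ 2 = g t $ 2" for t using g by simp_all
    show "continuous_on UNIV (\<lambda>t. g t $ 1)" "continuous_on UNIV (\<lambda>t. g t $ 2)"
      by (intro continuous_intros solution_continuous[OF g(2)])+
    show "\<exists>k::int. t = s + of_int k * T" if "g s $ 1 = g t $ 1" "g s $ 2 = g t $ 2" for s t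
    proof -
      have eq: "g s = g t" using that by (simp add: vec_eq_iff forall_2)
      obtain i :: int where i: "0 \<le> s + of_int i * T" "s + of_int i * T < 0 + T"
        using translate_into_period[OF g(1)] .
      obtain j :: int where j: "0 \<le> t + of_int j * T" "t + of_int j * T < 0 + T"
        using translate_into_period[OF g(1)] .
      have "g (s + of_int i * T) = g (t + of_int j * T)"
        using eq periodic_int[of g T, OF g(3)] by simp
      then have "s + of_int i * T = t + of_int j * T" using inj_onD[OF g(4)] i j by auto
      then show ?thesis by (intro exI[of _ "i - j"]) (simp add: algebra_simps)
    qed
    show "\<exists>t. g t $ 1 < 0"
    proof (rule ccontr)
      let ?H = "{z :: real^2. z $ 1 < 0}"
      assume "\<not> (\<exists>t. g t $ 1 < 0)"
      then have "?H \<subseteq> - C" using g(5) by auto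
      moreover have "connected ?H"
        using convex_halfspace_lt[of "axis 1 1 :: real^2" 0]
        by (intro convex_connected) (simp add: inner_axis')
      ultimately have "?H \<subseteq> connected_component_set (- C) p"
        using p(2) by (intro connected_component_maximal) auto
      moreover have "bounded (connected_component_set (- C) p)"
        using p(1) by (simp add: inside_def)
      ultimately have "bounded ?H" by (rule bounded_subset[rotated])
      then obtain B where B: "\<And>z. z \<in> ?H \<Longrightarrow> norm z \<le> B" by (auto simp: bounded_iff)
      define z :: "real^2" where "z = vector [- (\<bar>B\<bar> + 1), 0]"
      have "z \<in> ?H" by (simp add: z_def)
      moreover have "norm z \<ge> \<bar>z $ 1\<bar>" by (rule component_le_norm_cart)
      moreover have "\<bar>z $ 1\<bar> > B" by (simp add: z_def)
      ultimately show False using B by fastforce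
    qed
  qed
  with g show thesis using that by blast
qed

section \<open>Transversal crossing of the switching line\<close>

lemma solution_component_ge:
  fixes g :: "real \<Rightarrow> real^2"
  assumes "solution F g" "a \<le> b"
    and ge: "\<And>q w. a \<le> q \<Longrightarrow> q \<le> b \<Longrightarrow> w \<in> F (g q) \<Longrightarrow> c \<le> \<sigma> * w $ i"
  shows "c * (b - a) \<le> \<sigma> * (g b $ i - g a $ i)"
proof -
  obtain N v where N: "negligible N" "\<And>t. t \<notin> N \<Longrightarrow> v t \<in> F (g t)"
    and v: "\<And>s t. s \<le> t \<Longrightarrow> (v has_integral (g t - g s)) {s..t}"
    using solution_integral[OF assms(1)] by auto
  have "((\<lambda>q. v q $ i) has_integral (g b - g a) $ i) {a..b}"
    using has_integral_linear[OF v[OF assms(2)] bounded_linear_vec_nth[of i]] unfolding o_def .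
  then have "((\<lambda>q. \<sigma> * v q $ i) has_integral \<sigma> * (g b - g a) $ i) {a..b}"
    by (rule has_integral_mult_right)
  then have upper: "((\<lambda>q. if q \<in> N then c else \<sigma> * v q $ i) has_integral \<sigma> * (g b - g a) $ i) {a..b}"
    by (rule has_integral_spike[OF N(1), rotated]) auto
  have lower: "((\<lambda>q. c) has_integral c * (b - a)) {a..b}"
    using has_integral_const_real[of c a b] assms(2) by (simp add: mult.commute)
  \<comment> \<open>The integrand was set to \<open>c\<close> on the null set \<open>N\<close> so
    that the comparison holds at every point.\<close>
  have "c \<le> (if q \<in> N then c else \<sigma> * v q $ i)" if "q \<in> {a..b}" for q
    using N(2)[of q] ge[of q "v q"] that by auto
  from has_integral_le[OF lower upper this] show ?thesis by simp
qed

text \<open>Near \<open>g s\<close> both fields have speed at least some \<open>c > 0\<close> in the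
  direction \<open>\<sigma>\<close>, and so has every convex combination. Thus
  \<open>\<sigma> * g t $ 1\<close> increases strictly through zero, whichever selection the
  solution follows. The values \<open>1\<close> and \<open>- 1\<close> of \<open>\<sigma>\<close>
  give the two crossing directions.\<close>

lemma filippov_crossing:
  assumes sol: "solution (filippov X Y) g"
    and X: "continuous_on UNIV X" and Y: "continuous_on UNIV Y"
    and s: "g s $ 1 = 0" "\<sigma> * X (g s) $ 1 > 0" "\<sigma> * Y (g s) $ 1 > 0"
  shows "\<exists>\<delta>>0. (\<forall>t. s - \<delta> < t \<and> t < s \<longrightarrow> \<sigma> * g t $ 1 < 0) \<and>
    (\<forall>t. s < t \<and> t < s + \<delta> \<longrightarrow> \<sigma> * g t $ 1 > 0)"
proof -
  define m where "m = (\<lambda>t. min (\<sigma> * X (g t) $ 1) (\<sigma> * Y (g t) $ 1))"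
  define c where "c = m s / 2"
  have c: "0 < c" "c < m s" using s by (auto simp: c_def m_def)
  have cont: "continuous_on UNIV (\<lambda>t. Z (g t))" if "continuous_on UNIV Z" for Z :: "real^2 \<Rightarrow> real^2"
    using continuous_on_compose2[OF that solution_continuous[OF sol]] by auto
  have "continuous_on UNIV m" unfolding m_def by (intro continuous_intros cont X Y)
  then have "open {t. c < m t}" by (intro open_Collect_less continuous_intros)
  then obtain \<delta> where \<delta>: "\<delta> > 0" "ball s \<delta> \<subseteq> {t. c < m t}"
    using c by (auto simp: open_contains_ball)
  have F: "c \<le> \<sigma> * w $ 1" if "w \<in> filippov X Y (g q)" "\<bar>q - s\<bar> < \<delta>" for q w
  proof -
    have "q \<in> ball s \<delta>" using that(2) by (simp add: dist_real_def abs_minus_commute)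
    then have "c < m q" using \<delta>(2) by blast
    then have XY: "c \<le> \<sigma> * X (g q) $ 1" "c \<le> \<sigma> * Y (g q) $ 1" by (auto simp: m_def)
    have "w \<in> closed_segment (X (g q)) (Y (g q))"
      using that(1) by (auto simp: filippov_def split: if_splits)
    then obtain \<mu> where \<mu>: "0 \<le> \<mu>" "\<mu> \<le> 1" "w = (1 - \<mu>) *\<^sub>R X (g q) + \<mu> *\<^sub>R Y (g q)"
      by (auto simp: in_segment)
    have "(1 - \<mu>) * c + \<mu> * c \<le> (1 - \<mu>) * (\<sigma> * X (g q) $ 1) + \<mu> * (\<sigma> * Y (g q) $ 1)"
      using XY \<mu> by (intro add_mono mult_left_mono) auto
    also have "\<dots> = \<sigma> * w $ 1" unfolding \<mu>(3) by (simp add: algebra_simps)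
    finally show ?thesis by (simp add: algebra_simps)
  qed
  have increases: "\<sigma> * g a $ 1 < \<sigma> * g b $ 1" if "a < b" "s - \<delta> < a" "b < s + \<delta>" for a b
  proof -
    have "c * (b - a) \<le> \<sigma> * (g b $ 1 - g a $ 1)"
      using that by (intro solution_component_ge[OF sol]) (auto intro!: F)
    moreover have "c * (b - a) > 0" using c that by simp
    ultimately show ?thesis by (simp add: algebra_simps)
  qed
  show ?thesis
    using \<delta>(1) s(1) increases[of _ s] increases[of s] by (intro exI[of _ \<delta>]) auto
qed

text \<open>Twice the Hamiltonian of a traceless affine field: its \<open>y\<close>-derivative is
  \<open>2 x'\<close> and its \<open>x\<close>-derivative is \<open>- 2 y'\<close>.\<close>

definition hamiltonian :: "real^2^2 \<Rightarrow> real^2 \<Rightarrow> real^2 \<Rightarrow> real" where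
  "hamiltonian M u z = M $ 1 $ 2 * (z $ 2)\<^sup>2 + 2 * M $ 1 $ 1 * z $ 1 * z $ 2 - M $ 2 $ 1 * (z $ 1)\<^sup>2
    + 2 * u $ 1 * z $ 2 - 2 * u $ 2 * z $ 1"

lemma hamiltonian_constant:
  assumes tr: "M $ 2 $ 2 = - M $ 1 $ 1"
    and der: "\<And>q. q \<in> {s..t} \<Longrightarrow> (g has_vector_derivative affine_field M u (g q)) (at q within {s..t})"
    and "p \<in> {s..t}" "q \<in> {s..t}"
  shows "hamiltonian M u (g p) = hamiltonian M u (g q)"
proof -
  have "((\<lambda>q. hamiltonian M u (g q)) has_real_derivative 0) (at q within {s..t})" if "q \<in> {s..t}" for q
    unfolding hamiltonian_def
    using has_vector_derivative_component[OF der[OF that], of 1]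
      has_vector_derivative_component[OF der[OF that], of 2]
    by (auto intro!: derivative_eq_intros simp: affine_field_component tr algebra_simps power2_eq_square)
  then have "((\<lambda>q. hamiltonian M u (g q)) has_vector_derivative 0) (at q within {s..t})"
    if "q \<in> {s..t}" for q
    using that by (simp add: has_real_derivative_iff_has_vector_derivative)
  then obtain c where "\<And>q. q \<in> {s..t} \<Longrightarrow> hamiltonian M u (g q) = c"
    using has_vector_derivative_zero_constant[of "{s..t}"] by (metis convex_real_interval(5))
  with assms show ?thesis by simp
qed

text \<open>Let \<open>v\<close> be the value of \<open>x'\<close> on the line. Equal energy at both
  ends factors as the difference of the heights times \<open>v s + v t\<close>. The signs of
  \<open>v\<close> come from the orbit entering and leaving the side \<open>\<sigma>\<close>; if the
  heights coincide they force \<open>v = 0\<close>, so the common end is the fold.\<close>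

lemma affine_arc:
  fixes \<sigma> :: real
  assumes tr: "M $ 2 $ 2 = - M $ 1 $ 1" and M: "M $ 1 $ 2 \<noteq> 0" and "s < t" "\<sigma> \<noteq> 0"
    and der: "\<And>q. q \<in> {s..t} \<Longrightarrow> (g has_vector_derivative affine_field M u (g q)) (at q within {s..t})"
    and ends: "g s $ 1 = 0" "g t $ 1 = 0"
    and side: "\<And>q. s < q \<Longrightarrow> q < t \<Longrightarrow> \<sigma> * g q $ 1 > 0"
  shows "g s $ 2 + g t $ 2 = 2 * (- u $ 1 / M $ 1 $ 2) \<and>
    \<sigma> * (M $ 1 $ 2 * (g s $ 2 - (- u $ 1 / M $ 1 $ 2))) \<ge> 0"
proof -
  define v where "v = (\<lambda>q. M $ 1 $ 2 * g q $ 2 + u $ 1)"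
  have D: "((\<lambda>q. \<sigma> * g q $ 1) has_real_derivative \<sigma> * v q) (at q within {s..t})"
    if "q \<in> {s..t}" "g q $ 1 = 0" for q
    using has_vector_derivative_component[OF der[OF that(1)], of 1] that(2)
    by (intro DERIV_cmult) (simp add: affine_field_component v_def)
  have "\<sigma> * v s \<ge> 0"
  proof (rule ccontr)
    assume "\<not> \<sigma> * v s \<ge> 0"
    then obtain d where d: "d > 0" "\<And>h. h > 0 \<Longrightarrow> s + h \<in> {s..t} \<Longrightarrow> h < d \<Longrightarrow> \<sigma> * g (s + h) $ 1 < \<sigma> * g s $ 1"
      using has_real_derivative_neg_dec_right[OF D[of s]] ends \<open>s < t\<close> by auto
    define h where "h = min d (t - s) / 2"
    have "h > 0" "h < d" "h < t - s" using d(1) \<open>s < t\<close> by (auto simp: h_def min_def)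
    then show False using d(2)[of h] side[of "s + h"] ends by auto
  qed
  have "\<sigma> * v t \<le> 0"
  proof (rule ccontr)
    assume "\<not> \<sigma> * v t \<le> 0"
    then obtain d where d: "d > 0" "\<And>h. h > 0 \<Longrightarrow> t - h \<in> {s..t} \<Longrightarrow> h < d \<Longrightarrow> \<sigma> * g (t - h) $ 1 < \<sigma> * g t $ 1"
      using has_real_derivative_pos_inc_left[OF D[of t]] ends \<open>s < t\<close> by auto
    define h where "h = min d (t - s) / 2"
    have "h > 0" "h < d" "h < t - s" using d(1) \<open>s < t\<close> by (auto simp: h_def min_def)
    then show False using d(2)[of h] side[of "t - h"] ends by auto
  qed
  have "hamiltonian M u (g s) = hamiltonian M u (g t)"
    using \<open>s < t\<close> by (intro hamiltonian_constant[OF tr der]) auto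
  then have "(g s $ 2 - g t $ 2) * (v s + v t) = 0"
    using ends by (simp add: hamiltonian_def v_def algebra_simps power2_eq_square)
  moreover have "v s + v t = 0" if "g s $ 2 = g t $ 2"
  proof -
    have "v s = v t" using that by (simp add: v_def)
    with \<open>\<sigma> * v s \<ge> 0\<close> \<open>\<sigma> * v t \<le> 0\<close> have "\<sigma> * v t = 0" by simp
    with \<open>v s = v t\<close> \<open>\<sigma> \<noteq> 0\<close> show ?thesis by simp
  qed
  ultimately have "v s + v t = 0" by auto
  then have "M $ 1 $ 2 * (g s $ 2 + g t $ 2) = - 2 * u $ 1" by (simp add: v_def algebra_simps)
  moreover have "M $ 1 $ 2 * (g s $ 2 - (- u $ 1 / M $ 1 $ 2)) = v s" using M by (simp add: v_def field_simps)
  ultimately show ?thesis using M \<open>\<sigma> * v s \<ge> 0\<close> by (simp add: field_simps)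
qed

text \<open>All assumptions of \<open>crossing_orbit\<close> except \<open>long_arc\<close> hold for
  any closed orbit around \<open>p\<close>. A long arc is obtained by picking the orbit through a
  point \<open>(1, Y)\<close> high above and comparing energies.\<close>

lemma global_center_folds:
  assumes center: "is_global_center (filippov (affine_field P u) (affine_field M w)) p" "p $ 1 < 0"
    and tr: "P $ 2 $ 2 = - P $ 1 $ 1" "M $ 2 $ 2 = - M $ 1 $ 1"
    and nz: "P $ 1 $ 2 \<noteq> 0" "M $ 1 $ 2 \<noteq> 0"
  shows "M $ 1 $ 2 * P $ 1 $ 2 > 0 \<and> - w $ 1 / M $ 1 $ 2 = - u $ 1 / P $ 1 $ 2"
proof -
  let ?F = "filippov (affine_field P u) (affine_field M w)"
  define \<alpha> where "\<alpha> = M $ 1 $ 2"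
  define \<beta> where "\<beta> = P $ 1 $ 2"
  define l where "l = - w $ 1 / \<alpha>"
  define r where "r = - u $ 1 / \<beta>"
  \<comment> \<open>Dividing the energy at \<open>(1, Y)\<close> by \<open>\<beta>\<close> and
    completing the square on \<open>x = 0\<close> gives \<open>Y\<^sup>2 + A * Y + B\<close> for the
    squared distance of the arc's start from \<open>r\<close>. \<open>Y\<close> is chosen with
    \<open>Y - \<bar>A\<bar> = \<bar>B\<bar> + K + 1\<close>, so that this exceeds
    \<open>K\<close>.\<close>
  define A where "A = 2 * (P $ 1 $ 1 + u $ 1) / \<beta>"
  define B where "B = (- P $ 2 $ 1 - 2 * u $ 2) / \<beta> + r\<^sup>2"
  define K where "K = (r - l)\<^sup>2"
  define Y where "Y = \<bar>A\<bar> + \<bar>B\<bar> + K + 1"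
  define z :: "real^2" where "z = vector [1, Y]"
  have nz': "\<alpha> \<noteq> 0" "\<beta> \<noteq> 0" using nz by (simp_all add: \<alpha>_def \<beta>_def)
  have far: "K < Y\<^sup>2 + A * Y + B"
  proof -
    have "K \<ge> 0" by (simp add: K_def)
    then have "Y \<ge> 1" by (simp add: Y_def)
    have "1 * (\<bar>B\<bar> + K + 1) \<le> Y * (\<bar>B\<bar> + K + 1)"
      using \<open>K \<ge> 0\<close> \<open>Y \<ge> 1\<close> by (intro mult_right_mono) auto
    also have "\<dots> = Y * (Y - \<bar>A\<bar>)" by (simp add: Y_def)
    also have "\<dots> \<le> Y * (Y + A)" using \<open>Y \<ge> 1\<close> by (intro mult_left_mono) auto
    also have "\<dots> = Y\<^sup>2 + A * Y" by (simp add: power2_eq_square algebra_simps)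
    finally have "\<bar>B\<bar> + K + 1 \<le> Y\<^sup>2 + A * Y" by simp
    with abs_ge_minus_self[of B] show ?thesis by linarith
  qed
  have "z \<noteq> p" using center(2) by (auto simp: z_def)
  then have "z \<in> period_annulus ?F p" using center(1) by (simp add: is_global_center_def)
  then obtain C where C: "periodic_orbit ?F C" "p \<in> inside C" "z \<in> C"
    by (auto simp: period_annulus_def)
  obtain g T where sol: "solution ?F g" and "C = range g"
    and "closed_curve (\<lambda>t. g t $ 1) (\<lambda>t. g t $ 2) T"
    using closed_curve_of_orbit[OF C(1,2) center(2)] .
  then interpret closed_curve "\<lambda>t. g t $ 1" "\<lambda>t. g t $ 2" T by simp
  have der_right: "(g has_vector_derivative affine_field P u (g q)) (at q within {s..t})"
    if "\<And>q. s < q \<Longrightarrow> q < t \<Longrightarrow> g q $ 1 > 0" "q \<in> {s..t}" for s t q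
    by (rule solution_has_vector_derivative[OF sol continuous_affine_field])
      (use that in \<open>auto simp: filippov_def\<close>)
  have der_left: "(g has_vector_derivative affine_field M w (g q)) (at q within {s..t})"
    if "\<And>q. s < q \<Longrightarrow> q < t \<Longrightarrow> g q $ 1 < 0" "q \<in> {s..t}" for s t q
    by (rule solution_has_vector_derivative[OF sol continuous_affine_field])
      (use that in \<open>force simp: filippov_def\<close>)+
  have on_line: "affine_field P u z $ 1 = \<beta> * (z $ 2 - r)" "affine_field M w z $ 1 = \<alpha> * (z $ 2 - l)"
    if "z $ 1 = 0" for z
    using that nz' by (simp_all add: affine_field_component \<alpha>_def \<beta>_def l_def r_def field_simps)
  note crossing = filippov_crossing[OF sol continuous_affine_field continuous_affine_field]
  interpret crossing_orbit "\<lambda>t. g t $ 1" "\<lambda>t. g t $ 2" T \<alpha> \<beta> l r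
  proof
    show "g s $ 2 + g t $ 2 = 2 * r \<and> \<beta> * (g s $ 2 - r) \<ge> 0"
      if "s < t" "g s $ 1 = 0" "g t $ 1 = 0" "\<And>q. s < q \<Longrightarrow> q < t \<Longrightarrow> g q $ 1 > 0" for s t
      using affine_arc[OF tr(1) nz(1) that(1) _ der_right that(2,3), of 1] that
      by (simp add: r_def \<beta>_def)
    show "g s $ 2 + g t $ 2 = 2 * l \<and> \<alpha> * (g s $ 2 - l) \<le> 0"
      if "s < t" "g s $ 1 = 0" "g t $ 1 = 0" "\<And>q. s < q \<Longrightarrow> q < t \<Longrightarrow> g q $ 1 < 0" for s t
      using affine_arc[OF tr(2) nz(2) that(1) _ der_left that(2,3), of "- 1"] that
      by (simp add: l_def \<alpha>_def)
    show "\<exists>\<delta>>0. (\<forall>t. s - \<delta> < t \<and> t < s \<longrightarrow> g t $ 1 < 0) \<and> (\<forall>t. s < t \<and> t < s + \<delta> \<longrightarrow> g t $ 1 > 0)"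
      if "g s $ 1 = 0" "\<alpha> * (g s $ 2 - l) > 0" "\<beta> * (g s $ 2 - r) > 0" for s
      using crossing[of s 1] that on_line by simp
    show "\<exists>\<delta>>0. (\<forall>t. s - \<delta> < t \<and> t < s \<longrightarrow> g t $ 1 > 0) \<and> (\<forall>t. s < t \<and> t < s + \<delta> \<longrightarrow> g t $ 1 < 0)"
      if "g s $ 1 = 0" "\<alpha> * (g s $ 2 - l) < 0" "\<beta> * (g s $ 2 - r) < 0" for s
      using crossing[of s "- 1"] that on_line by simp
    show "\<exists>s t. s < t \<and> g s $ 1 = 0 \<and> g t $ 1 = 0 \<and> (\<forall>q. s < q \<and> q < t \<longrightarrow> g q $ 1 > 0) \<and>
      \<bar>g s $ 2 - r\<bar> > \<bar>r - l\<bar>"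
    proof -
      from C(3) \<open>C = range g\<close> obtain t0 where t0: "g t0 = z" by auto
      then obtain s t where st: "s < t0" "t0 < t" "g s $ 1 = 0" "g t $ 1 = 0"
        "\<And>q. s < q \<Longrightarrow> q < t \<Longrightarrow> g q $ 1 > 0"
        using right_arcE[of t0] by (auto simp: z_def)
      have "hamiltonian P u (g s) = hamiltonian P u z"
        unfolding t0[symmetric]
        by (rule hamiltonian_constant[OF tr(1) der_right[OF st(5)]]) (use st in auto)
      then have energy: "\<beta> * (g s $ 2)\<^sup>2 + 2 * u $ 1 * g s $ 2 =
          \<beta> * Y\<^sup>2 + 2 * P $ 1 $ 1 * Y - P $ 2 $ 1 + 2 * u $ 1 * Y - 2 * u $ 2"
        using st(3) by (simp add: hamiltonian_def z_def \<beta>_def)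
      have start: "\<beta> * (g s $ 2 - r)\<^sup>2 =
          \<beta> * (g s $ 2)\<^sup>2 - 2 * (\<beta> * r) * g s $ 2 + \<beta> * r\<^sup>2"
        by (simp add: power2_eq_square algebra_simps)
      have top: "\<beta> * (Y\<^sup>2 + A * Y + B) = \<beta> * Y\<^sup>2 + (\<beta> * A) * Y + \<beta> * B"
        by (simp add: algebra_simps)
      have coeffs: "\<beta> * r = - u $ 1" "\<beta> * A = 2 * (P $ 1 $ 1 + u $ 1)"
        using nz' by (simp_all add: r_def A_def)
      have const: "\<beta> * B = - P $ 2 $ 1 - 2 * u $ 2 + \<beta> * r\<^sup>2"
        using nz' by (simp add: B_def distrib_left)
      have "\<beta> * (g s $ 2 - r)\<^sup>2 = \<beta> * (Y\<^sup>2 + A * Y + B)"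
        unfolding start top coeffs const using energy by (simp add: algebra_simps)
      then have "(g s $ 2 - r)\<^sup>2 = Y\<^sup>2 + A * Y + B" using nz' by simp
      with far have "(r - l)\<^sup>2 < (g s $ 2 - r)\<^sup>2" by (simp add: K_def)
      then have "\<bar>r - l\<bar> < \<bar>g s $ 2 - r\<bar>" by (metis abs_le_square_iff not_le)
      with st show ?thesis by (intro exI[of _ s] exI[of _ t]) auto
    qed
  qed
  show ?thesis
    using same_direction_same_fold[OF nz'] by (simp add: \<alpha>_def \<beta>_def l_def r_def)
qed

section \<open>The canonical form\<close>

lemma matrix_inverse_2:
  fixes k p q :: real
  assumes "k \<noteq> 0" "q \<noteq> 0"
  defines "A \<equiv> vector [vector [k, 0], vector [p, q]] :: real^2^2"
    and "B \<equiv> vector [vector [1 / k, 0], vector [- p / (k * q), 1 / q]] :: real^2^2"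
  shows "A ** B = mat 1" "B ** A = mat 1"
  using assms(1,2)
  by (auto simp: A_def B_def vec_eq_iff forall_2 matrix_matrix_mult_def sum_2 mat_def field_simps)

lemma coordinate_time_change_affine:
  fixes A :: "real^2^2"
  assumes "\<sigma> > 0" "A $ 1 $ 1 > 0" "A $ 1 $ 2 = 0" "w $ 1 = 0" and inv: "A ** B = mat 1" "B ** A = mat 1"
  shows "coordinate_time_change (\<lambda>z. A *v z + w) \<sigma>"
proof -
  let ?h = "\<lambda>z. A *v z + w"
  have first: "?h z $ 1 = A $ 1 $ 1 * z $ 1" for z
    using assms by (simp add: matrix_vector_mult_def sum_2)
  have onto: "z = ?h (B *v (z - w))" for z
    by (simp add: matrix_vector_mul_assoc inv)
  have "A $ 1 $ 1 * (B *v (z - w)) $ 1 = z $ 1" for z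
    using first[of "B *v (z - w)"] onto[of z] by simp
  then have "(B *v (z - w)) $ 1 \<ge> 0 \<longleftrightarrow> z $ 1 \<ge> 0" "(B *v (z - w)) $ 1 \<le> 0 \<longleftrightarrow> z $ 1 \<le> 0" for z
    using assms(2) by (metis mult_nonneg_nonneg mult_pos_neg not_le less_imp_le
      mult_le_0_iff zero_le_mult_iff not_less)+
  then have "?h ` right_half = right_half" "?h ` left_half = left_half"
    using first assms(2) onto unfolding right_half_def left_half_def
    by (fastforce simp: zero_le_mult_iff mult_le_0_iff image_iff)+
  moreover have "invertible A" using inv by (auto simp: invertible_def)
  ultimately show ?thesis
    using assms(1,2) first unfolding coordinate_time_change_def by blast
qed

lemma written_as_affine:
  fixes A B M :: "real^2^2"
  assumes "\<sigma> \<noteq> 0" "B ** A = mat 1"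
  shows "written_as (\<lambda>z. A *v z + w) \<sigma> S (affine_field M u)
    (affine_field ((1 / \<sigma>) *\<^sub>R (A ** M ** B)) ((1 / \<sigma>) *\<^sub>R (A *v u - (A ** M ** B) *v w)))"
  unfolding written_as_def
proof (intro ballI exI conjI)
  fix z
  show "((\<lambda>z. A *v z + w) has_derivative (\<lambda>z. A *v z)) (at z)"
    by (auto intro!: derivative_eq_intros bounded_linear.has_derivative[OF matrix_vector_mul_bounded_linear])
  have "(A ** M ** B) *v (A *v z + w) = A *v (M *v z) + (A ** M ** B) *v w"
    by (simp add: matrix_vector_right_distrib matrix_vector_mul_assoc assms(2) flip: matrix_mul_assoc)
  then show "A *v affine_field M u z = \<sigma> *\<^sub>R affine_field ((1 / \<sigma>) *\<^sub>R (A ** M ** B))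
      ((1 / \<sigma>) *\<^sub>R (A *v u - (A ** M ** B) *v w)) (A *v z + w)"
    using assms(1)
    by (simp add: affine_field_def matrix_vector_right_distrib scaleR_add_right scaleR_matrix_vector_assoc[symmetric])
qed

text \<open>Used for both sides with the same change of variables. The assumption
  \<open>fold\<close> says that \<open>y~ = 0\<close> meets the line at the tangency point of
  \<open>M\<close>; this makes the first component of the new constant vanish.\<close>

lemma transformed_coefficients:
  fixes M A B :: "real^2^2" and u :: "real^2" and k p q v :: real
  assumes "k \<noteq> 0" "q \<noteq> 0" and tr: "M $ 2 $ 2 = - M $ 1 $ 1"
    and fold: "q * u $ 1 = M $ 1 $ 2 * v"
  defines "A \<equiv> vector [vector [k, 0], vector [- p, - q]]"
    and "B \<equiv> vector [vector [1 / k, 0], vector [- (- p) / (k * - q), 1 / - q]]"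
    and "w \<equiv> vector [0, - v]"
  shows "(1 / k) *\<^sub>R (A ** M ** B) = vector [
      vector [(M $ 1 $ 1 - p * M $ 1 $ 2 / q) / k, - (M $ 1 $ 2 / q)],
      vector [(p\<^sup>2 * M $ 1 $ 2 / q - 2 * p * M $ 1 $ 1 - q * M $ 2 $ 1) / k\<^sup>2,
        - ((M $ 1 $ 1 - p * M $ 1 $ 2 / q) / k)]]" (is ?matrix)
    and "M $ 1 $ 2 \<noteq> 0 \<Longrightarrow> (1 / k) *\<^sub>R (A *v u - (A ** M ** B) *v w) =
      vector [0, - (q * (u $ 2 + M $ 1 $ 1 * u $ 1 / M $ 1 $ 2) / k)]"
proof -
  show matrix: ?matrix
    using assms(1,2)
    by (simp add: A_def B_def vec_eq_iff forall_2 matrix_matrix_mult_def sum_2 tr field_simps power2_eq_square)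
  show "(1 / k) *\<^sub>R (A *v u - (A ** M ** B) *v w) =
      vector [0, - (q * (u $ 2 + M $ 1 $ 1 * u $ 1 / M $ 1 $ 2) / k)]" if nz: "M $ 1 $ 2 \<noteq> 0"
  proof -
    have v: "v = q * u $ 1 / M $ 1 $ 2" using fold nz by (simp add: field_simps)
    have eq: "(1 / k) *\<^sub>R (A *v u - (A ** M ** B) *v w) = (1 / k) *\<^sub>R (A *v u) - ((1 / k) *\<^sub>R (A ** M ** B)) *v w"
      by (simp add: scaleR_right_diff_distrib scaleR_matrix_vector_assoc)
    show ?thesis
      unfolding eq matrix using assms(1,2) nz
      by (simp add: A_def w_def v vec_eq_iff forall_2 matrix_vector_mult_def sum_2 field_simps)
  qed
qed

text \<open>With \<open>\<Delta> = - (m\<^sub>1\<^sub>1\<^sup>2 + m\<^sub>1\<^sub>2 m\<^sub>2\<^sub>1)\<close> the singular point of a traceless system has abscissa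
  \<open>m\<^sub>1\<^sub>2 u\<^sub>2 / \<Delta>\<close> for the shifted \<open>u\<^sub>2\<close>.\<close>

lemma shifted_constant_sign:
  assumes sing: "affine_field M u p = 0" and tr: "M $ 2 $ 2 = - M $ 1 $ 1"
    and det: "(M $ 1 $ 1)\<^sup>2 + M $ 1 $ 2 * M $ 2 $ 1 < 0" and "p $ 1 < 0"
  shows "M $ 1 $ 2 * (u $ 2 + M $ 1 $ 1 * u $ 1 / M $ 1 $ 2) < 0"
proof -
  have nz: "M $ 1 $ 2 \<noteq> 0" using det by auto
  have "M $ 1 $ 1 * p $ 1 + M $ 1 $ 2 * p $ 2 + u $ 1 = 0" "M $ 2 $ 1 * p $ 1 - M $ 1 $ 1 * p $ 2 + u $ 2 = 0"
    using arg_cong[OF sing, of "\<lambda>z. z $ 1"] arg_cong[OF sing, of "\<lambda>z. z $ 2"]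
    by (simp_all add: affine_field_component tr)
  then have u: "u $ 1 = - (M $ 1 $ 1 * p $ 1 + M $ 1 $ 2 * p $ 2)" "u $ 2 = M $ 1 $ 1 * p $ 2 - M $ 2 $ 1 * p $ 1"
    by linarith+
  have "M $ 1 $ 2 * (u $ 2 + M $ 1 $ 1 * u $ 1 / M $ 1 $ 2) = M $ 1 $ 2 * u $ 2 + M $ 1 $ 1 * u $ 1"
    using nz by (simp add: field_simps)
  also have "\<dots> = - (((M $ 1 $ 1)\<^sup>2 + M $ 1 $ 2 * M $ 2 $ 1) * p $ 1)"
    unfolding u by (simp add: algebra_simps power2_eq_square)
  also have "\<dots> < 0" using mult_neg_neg[OF det assms(4)] by simp
  finally show ?thesis .
qed

theorem proposition1:
  fixes Mp Mm :: "real \<Rightarrow> real^2^2"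
    and up um :: "real \<Rightarrow> real^2"
    and pp pm :: "real^2"
    and m11p m12p m21p m11m m12m m21m u2p u2m \<rho> a b c d e :: real
  assumes H1: "is_center (ode_system (affine_field (Mm 0) (um 0))) pm" "pm $ 1 < 0"
    and H2: "is_center (ode_system (affine_field (Mp 0) (up 0))) pp" "pp $ 1 < 0"
    and H3: "is_global_center
               (filippov (affine_field (Mp 0) (up 0)) (affine_field (Mm 0) (um 0))) pm"
    and "m11p = Mp 0 $ 1 $ 1" "m12p = Mp 0 $ 1 $ 2" "m21p = Mp 0 $ 2 $ 1"
    and "m11m = Mm 0 $ 1 $ 1" "m12m = Mm 0 $ 1 $ 2" "m21m = Mm 0 $ 2 $ 1"
    and "u2p = up 0 $ 2 + m11p * up 0 $ 1 / m12p"
    and "u2m = um 0 $ 2 + m11m * um 0 $ 1 / m12m"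
    and "\<rho> = sqrt \<bar>det (Mm 0)\<bar>"
    and "a = 1 / \<rho> * (m11p - m11m * m12p / m12m)"
    and "b = - (m12p / m12m)"
    and "c = 1 / \<rho>\<^sup>2 * (m11m\<^sup>2 * m12p / m12m - 2 * m11m * m11p - m12m * m21p)"
    and "d = - (m12m * u2p / \<rho>)"
    and "e = - (m12m * u2m / \<rho>)"
  shows "(\<exists>h \<sigma> Np Nm vp vm.
            coordinate_time_change h \<sigma> \<and>
            (\<forall>\<epsilon>::real.
               written_as h \<sigma> right_half
                 (affine_field (Mp \<epsilon>) (up \<epsilon>)) (affine_field (Np \<epsilon>) (vp \<epsilon>)) \<and>
               written_as h \<sigma> left_half
                 (affine_field (Mm \<epsilon>) (um \<epsilon>)) (affine_field (Nm \<epsilon>) (vm \<epsilon>))) \<and>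
            Np 0 = vector [vector [a, b], vector [c, - a]] \<and> vp 0 = vector [0, d] \<and>
            Nm 0 = vector [vector [0, - 1], vector [1, 0]] \<and> vm 0 = vector [0, e])
         \<and> b < 0 \<and> c > 0 \<and> d > 0 \<and> e > 0 \<and> a\<^sup>2 + b * c < 0"
proof -
  have left: "affine_field (Mm 0) (um 0) pm = 0" "Mm 0 $ 2 $ 2 = - m11m" "m11m\<^sup>2 + m12m * m21m < 0"
    using linear_center_traceless_det_pos[OF H1(1)] by (simp_all add: assms)
  have right: "affine_field (Mp 0) (up 0) pp = 0" "Mp 0 $ 2 $ 2 = - m11p" "m11p\<^sup>2 + m12p * m21p < 0"
    using linear_center_traceless_det_pos[OF H2(1)] by (simp_all add: assms)
  have nz: "m12m \<noteq> 0" "m12p \<noteq> 0" using left(3) right(3) by auto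
  have folds: "m12m * m12p > 0" "- um 0 $ 1 / m12m = - up 0 $ 1 / m12p"
    using global_center_folds[OF H3 H1(2)] left(2) right(2) nz by (simp_all add: assms)
  have u_neg: "m12m * u2m < 0" "m12p * u2p < 0"
    using shifted_constant_sign[OF left(1) _ _ H1(2)] shifted_constant_sign[OF right(1) _ _ H2(2)]
      left(2,3) right(2,3) by (simp_all add: assms)
  have det: "det (Mm 0) = - (m11m\<^sup>2 + m12m * m21m)"
    using left(2) by (simp add: det_2 assms power2_eq_square)
  then have \<rho>: "\<rho> > 0" "\<rho>\<^sup>2 = - (m11m\<^sup>2 + m12m * m21m)"
    using left(3) by (simp_all add: \<open>\<rho> = _\<close>)

  \<comment> \<open>The new variables are \<open>\<rho> x\<close> and minus the left
    \<open>x'\<close>. With time scaled by \<open>\<rho>\<close> the left system then reads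
    \<open>x' = - y~\<close>.\<close>
  define A :: "real^2^2" where "A = vector [vector [\<rho>, 0], vector [- m11m, - m12m]]"
  \<comment> \<open>The double negation is kept to match the pattern of
    \<open>matrix_inverse_2\<close>.\<close>
  define B :: "real^2^2" where
    "B = vector [vector [1 / \<rho>, 0], vector [- (- m11m) / (\<rho> * - m12m), 1 / - m12m]]"
  define w :: "real^2" where "w = vector [0, - um 0 $ 1]"
  define N where "N = (\<lambda>M :: real^2^2. (1 / \<rho>) *\<^sub>R (A ** M ** B))"
  define v where "v = (\<lambda>(M :: real^2^2) u. (1 / \<rho>) *\<^sub>R (A *v u - (A ** M ** B) *v w))"
  have inv: "A ** B = mat 1" "B ** A = mat 1"
    unfolding A_def B_def using \<rho>(1) nz(1) by (intro matrix_inverse_2; simp)+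
  have "coordinate_time_change (\<lambda>z. A *v z + w) \<rho>"
    by (rule coordinate_time_change_affine[OF _ _ _ _ inv]) (use \<rho>(1) in \<open>simp_all add: A_def w_def\<close>)
  \<comment> \<open>The change is fixed once from the data at \<open>0\<close>; being affine, it
    conjugates every member of the family.\<close>
  moreover have "written_as (\<lambda>z. A *v z + w) \<rho> S (affine_field M u) (affine_field (N M) (v M u))" for S M u
    unfolding N_def v_def using \<rho>(1) inv(2) by (intro written_as_affine) auto
  moreover have "N (Mp 0) = vector [vector [a, b], vector [c, - a]]" "v (Mp 0) (up 0) = vector [0, d]"
  proof -
    \<comment> \<open>Coincidence of the folds, cleared of denominators, is the assumption
      \<open>fold\<close> for the right system.\<close>
    have "m12m * up 0 $ 1 = m12p * um 0 $ 1" using folds(2) nz by (simp add: field_simps)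
    note tc = transformed_coefficients[of \<rho> m12m "Mp 0" "up 0" "um 0 $ 1" m11m, folded A_def B_def w_def]
    have "N (Mp 0) = vector [
      vector [(m11p - m11m * m12p / m12m) / \<rho>, - (m12p / m12m)],
      vector [(m11m\<^sup>2 * m12p / m12m - 2 * m11m * m11p - m12m * m21p) / \<rho>\<^sup>2,
        - ((m11p - m11m * m12p / m12m) / \<rho>)]]"
      using tc(1) \<rho>(1) nz right(2) \<open>m12m * up 0 $ 1 = _\<close> by (simp add: N_def \<open>m11p = _\<close> \<open>m12p = _\<close> \<open>m21p = _\<close>)
    then show "N (Mp 0) = vector [vector [a, b], vector [c, - a]]"
      by (simp add: \<open>a = _\<close> \<open>b = _\<close> \<open>c = _\<close>)
    show "v (Mp 0) (up 0) = vector [0, d]"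
      using tc(2) \<rho>(1) nz right(2) \<open>m12m * up 0 $ 1 = _\<close>
      by (simp add: v_def \<open>d = _\<close> \<open>u2p = _\<close> \<open>m11p = _\<close> \<open>m12p = _\<close>)
  qed
  moreover have "N (Mm 0) = vector [vector [0, - 1], vector [1, 0]]" "v (Mm 0) (um 0) = vector [0, e]"
  proof -
    note tc = transformed_coefficients[of \<rho> m12m "Mm 0" "um 0" "um 0 $ 1" m11m, folded A_def B_def w_def]
    have "N (Mm 0) = vector [
      vector [(m11m - m11m * m12m / m12m) / \<rho>, - (m12m / m12m)],
      vector [(m11m\<^sup>2 * m12m / m12m - 2 * m11m * m11m - m12m * m21m) / \<rho>\<^sup>2,
        - ((m11m - m11m * m12m / m12m) / \<rho>)]]"
      using tc(1) \<rho>(1) nz left(2) by (simp add: N_def \<open>m11m = _\<close> \<open>m12m = _\<close> \<open>m21m = _\<close>)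
    also have "m11m\<^sup>2 * m12m / m12m - 2 * m11m * m11m - m12m * m21m = \<rho>\<^sup>2"
      using nz unfolding \<rho>(2) by (simp add: power2_eq_square)
    finally show "N (Mm 0) = vector [vector [0, - 1], vector [1, 0]]" using \<rho>(1) nz by simp
    show "v (Mm 0) (um 0) = vector [0, e]"
      using tc(2) \<rho>(1) nz left(2)
      by (simp add: v_def \<open>e = _\<close> \<open>u2m = _\<close> \<open>m11m = _\<close> \<open>m12m = _\<close>)
  qed
  ultimately have change: "coordinate_time_change (\<lambda>z. A *v z + w) \<rho> \<and>
      (\<forall>\<epsilon>. written_as (\<lambda>z. A *v z + w) \<rho> right_half (affine_field (Mp \<epsilon>) (up \<epsilon>))
          (affine_field (N (Mp \<epsilon>)) (v (Mp \<epsilon>) (up \<epsilon>))) \<and>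
        written_as (\<lambda>z. A *v z + w) \<rho> left_half (affine_field (Mm \<epsilon>) (um \<epsilon>))
          (affine_field (N (Mm \<epsilon>)) (v (Mm \<epsilon>) (um \<epsilon>)))) \<and>
      N (Mp 0) = vector [vector [a, b], vector [c, - a]] \<and> v (Mp 0) (up 0) = vector [0, d] \<and>
      N (Mm 0) = vector [vector [0, - 1], vector [1, 0]] \<and> v (Mm 0) (um 0) = vector [0, e]"
    by blast

  have "b < 0" using folds(1) by (auto simp: \<open>b = _\<close> zero_less_mult_iff divide_neg_neg)
  \<comment> \<open>Conjugation preserves the determinant, and the time scale divides it by
    \<open>\<rho>\<^sup>2\<close>.\<close>
  have abc: "a\<^sup>2 + b * c = (m11p\<^sup>2 + m12p * m21p) / \<rho>\<^sup>2"
    using \<rho>(1) nz by (simp add: \<open>a = _\<close> \<open>b = _\<close> \<open>c = _\<close> field_simps power2_eq_square)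
  then have neg: "a\<^sup>2 + b * c < 0" using right(3) \<rho>(1) by (simp add: divide_neg_pos)
  then have "b * c < 0" using zero_le_power2[of a] by linarith
  then have "c > 0" using \<open>b < 0\<close> by (simp add: mult_less_0_iff)
  have "e > 0" using u_neg(1) \<rho>(1) by (simp add: \<open>e = _\<close> divide_neg_pos)
  \<comment> \<open>The singular point controls the sign of \<open>m12p * u2p\<close>; equal
    crossing directions carry it over to \<open>m12m\<close>.\<close>
  have "m12m * u2p < 0" using u_neg(2) folds(1) by (auto simp: zero_less_mult_iff mult_less_0_iff)
  then have "d > 0" using \<rho>(1) by (simp add: \<open>d = _\<close> divide_neg_pos)
  show ?thesis
    by (rule conjI, rule exI[of _ "\<lambda>z. A *v z + w"], rule exI[of _ \<rho>],
        rule exI[of _ "\<lambda>\<epsilon>. N (Mp \<epsilon>)"], rule exI[of _ "\<lambda>\<epsilon>. N (Mm \<epsilon>)"],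
        rule exI[of _ "\<lambda>\<epsilon>. v (Mp \<epsilon>) (up \<epsilon>)"], rule exI[of _ "\<lambda>\<epsilon>. v (Mm \<epsilon>) (um \<epsilon>)"],
        rule change)
      (use \<open>b < 0\<close> \<open>c > 0\<close> \<open>d > 0\<close> \<open>e > 0\<close> neg in blast)
qed

end
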